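(* For every integer $b\ge1$, let $c_b(n)$ be the number of convex domino towers consisting of $n$ dominoes whose row of maximum length has $b$ dominoes. Then, as $n\to\infty$, $$c_b(n)\sim 2^{\,n-b+1}\prod_{k=1}^{b-1}\frac{2^k}{2^k-1}\cdot\left(1+\sum_{i=0}^{b-2}\frac{1}{\prod_{k=i+1}^{b-1}(2^k-1)}\right).$$
   Context: Cells are unit squares indexed by $(x,y)\in\mathbb{Z}^2$; a domino occupies a pair of cells $\{(x,y),(x+1,y)\}$; dominoes in a configuration do not overlap. For $n\ge b'\ge 1$, an $(n,b')$-domino tower is a polyomino (counted up to translation only) created by taking a base of $b'$ consecutive dominoes in a single row (a contiguous horizontal strip of $2b'$ cells) and sequentially placing $n-b'$ further horizontal dominoes so that if a non-base domino is placed at $\{(x,y),(x+1,y)\}$ then there is a domino at $\{(x-1,y-1),(x,y-1)\}$, $\{(x,y-1),(x+1,y-1)\}$ or $\{(x+1,y-1),(x+2,y-1)\}$. A domino tower is an $(n,b')$-domino tower for some $n,b'$. A row (column) is the intersection of the polyomino with an infinite horizontal (vertical) line of unit squares; the tower is convex if every row and every column consists of consecutive cells. The length of a row is its number of dominoes. Here $u_n\sim v_n$ means $u_n/v_n\to1$; empty products equal $1$ and empty sums equal $0$. *)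

theory Defs
  imports Complex_Main "HOL-Library.Landau_Symbols"
begin

type_synonym cell = "int \<times> int"

definition domino :: "int \<Rightarrow> int \<Rightarrow> cell set" where
  "domino x y = {(x, y), (x + 1, y)}"

text \<open>
  \<open>domino_tower n b' D\<close>: the set \<open>D\<close> of dominoes is obtained from a base of \<open>b'\<close> consecutive
  dominoes, at an arbitrary position in the plane, by sequentially placing \<open>n - b'\<close> further ones.
\<close>

inductive domino_tower :: "nat \<Rightarrow> nat \<Rightarrow> cell set set \<Rightarrow> bool" where
  base: "1 \<le> b' \<Longrightarrow> domino_tower b' b' ((\<lambda>j. domino (x + 2 * int j) y) ` {0..<b'})"
| place: "domino_tower n b' D \<Longrightarrow> domino x y \<inter> \<Union>D = {} \<Longrightarrow>
    domino (x - 1) (y - 1) \<in> D \<or> domino x (y - 1) \<in> D \<or> domino (x + 1) (y - 1) \<in> D \<Longrightarrow>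
    domino_tower (Suc n) b' (insert (domino x y) D)"

text \<open>The empty set is included (\<open>r < l\<close>), for lines missing the polyomino.\<close>

definition consecutive :: "int set \<Rightarrow> bool" where
  "consecutive S \<longleftrightarrow> (\<exists>l r. S = {l..r})"

definition convex_polyomino :: "cell set \<Rightarrow> bool" where
  "convex_polyomino P \<longleftrightarrow>
    (\<forall>y. consecutive {x. (x, y) \<in> P}) \<and> (\<forall>x. consecutive {y. (x, y) \<in> P})"

definition row_length :: "cell set set \<Rightarrow> int \<Rightarrow> nat" where
  "row_length D y = card {d \<in> D. d \<subseteq> UNIV \<times> {y}}"

definition translation_rel :: "(cell set \<times> cell set) set" where
  "translation_rel = {(P, Q). \<exists>dx dy. Q = (\<lambda>(x, y). (x + dx, y + dy)) ` P}"

lemma equiv_translation_rel: "equiv UNIV translation_rel"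
proof (rule equivI)
  show "translation_rel \<subseteq> UNIV \<times> UNIV" by simp
  show "refl translation_rel"
    by (auto simp: refl_on_def translation_rel_def intro!: exI[of _ 0])
  show "sym translation_rel"
  proof (rule symI)
    fix P Q assume "(P, Q) \<in> translation_rel"
    then obtain dx dy where "Q = (\<lambda>(x, y). (x + dx, y + dy)) ` P"
      by (auto simp: translation_rel_def)
    then have "P = (\<lambda>(x, y). (x + (- dx), y + (- dy))) ` Q"
      by (auto simp: image_image case_prod_beta)
    then show "(Q, P) \<in> translation_rel" unfolding translation_rel_def by blast
  qed
  show "trans translation_rel"
  proof (rule transI)
    fix P Q R assume "(P, Q) \<in> translation_rel" "(Q, R) \<in> translation_rel"
    then obtain dx dy ex ey where "Q = (\<lambda>(x, y). (x + dx, y + dy)) ` P"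
      "R = (\<lambda>(x, y). (x + ex, y + ey)) ` Q"
      by (auto simp: translation_rel_def)
    then have "R = (\<lambda>(x, y). (x + (dx + ex), y + (dy + ey))) ` P"
      by (simp add: image_image case_prod_beta add.assoc)
    then show "(P, R) \<in> translation_rel" unfolding translation_rel_def by blast
  qed
qed

text \<open>
  The towers counted are polyominoes, i.e. the unions of the cells of the dominoes. The maximum is
  over all rows of the plane; rows missing the tower have length 0 and do not affect it.
\<close>

definition convex_towers :: "nat \<Rightarrow> nat \<Rightarrow> cell set set" where
  "convex_towers b n = {\<Union>D | D b'. domino_tower n b' D \<and> convex_polyomino (\<Union>D) \<and>
    Max (range (row_length D)) = b}"

definition num_convex_towers :: "nat \<Rightarrow> nat \<Rightarrow> nat" where
  "num_convex_towers b n = card (convex_towers b n // translation_rel)"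

end

theory Submission
  imports Defs "HOL-Library.Disjoint_Sets"
begin

text \<open>
  A convex tower is read from the bottom up. In each step the left border may advance outwards by at
  most one cell and so may the right border, and convexity means that a border which has once
  retreated never advances again. As long as neither border has retreated, a row length is repeated
  in one way and increased by one in one way. If only the right border has retreated (a left-leaning
  tower), the lengths weakly decrease and every length up to the current one can follow in exactly
  two ways; if both have retreated, a length can be repeated in only one way. With weight \<open>1/2\<close> per
  domino the only critical state is therefore that of a leaning tower whose rows have length one, so
  leaning towers dominate and, up to a vanishing proportion, the left-leaning ones are half of all.
  Their limiting proportions satisfy linear recurrences: rows of length \<open>k\<close> contribute the factor
  \<open>1 / (1 - 2 / 2 ^ k)\<close> on the way down from \<open>b\<close> and \<open>1 / (2 ^ k - 1)\<close> on the way up to \<open>b\<close>.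
\<close>

section \<open>Linear recurrences\<close>

text \<open>The limit can only be the fixed point \<open>M\<close> of
  \<open>t \<mapsto> q * t + L\<close>. Boundedness of \<open>x\<close> comes first; then every
  \<open>k\<close> steps shrink the distance to \<open>M\<close> by the factor \<open>q\<close>, up
  to the deviation of \<open>y\<close> from \<open>L\<close>.\<close>

lemma linear_recurrence_tendsto:
  fixes x y :: "nat \<Rightarrow> real"
  assumes rec: "\<And>n. x n = (if k \<le> n then q * x (n - k) else 0) + y n"
    and k: "k \<ge> 1" and q: "0 \<le> q" "q < 1" and y: "y \<longlonglongrightarrow> L"
  shows "x \<longlonglongrightarrow> L / (1 - q)"
proof -
  define M where "M = L / (1 - q)"
  have M: "M = q * M + L"
    using q by (simp add: M_def field_simps)
  have "Bseq y" using y by (simp add: convergent_imp_Bseq convergentI)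
  then obtain B where B: "B > 0" "\<And>n. \<bar>y n\<bar> \<le> B" by (auto simp: Bseq_def)
  have bound: "\<bar>x n\<bar> \<le> B / (1 - q)" for n
  proof (induction n rule: less_induct)
    case (less n)
    have "q * \<bar>x (n - k)\<bar> \<le> q * (B / (1 - q))" if "k \<le> n"
      using less[of "n - k"] k q that by (intro mult_left_mono) auto
    moreover have "0 \<le> q * (B / (1 - q))"
      using q B by simp
    ultimately have "\<bar>if k \<le> n then q * x (n - k) else 0\<bar> \<le> q * (B / (1 - q))"
      using q by (simp add: abs_mult del: times_divide_eq_right)
    then have "\<bar>x n\<bar> \<le> q * (B / (1 - q)) + B"
      using B(2)[of n] rec[of n] by linarith
    also have "\<dots> = B / (1 - q)" using q by (simp add: field_simps)
    finally show ?case .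
  qed
  define K where "K = B / (1 - q) + \<bar>M\<bar>"
  \<comment> \<open>The initial distance, at most \<open>K\<close>, has shrunk to
    \<open>q ^ m * K\<close> after \<open>m\<close> contractions; the errors \<open>e\<close> of the
    single steps add up to at most the geometric series \<open>e / (1 - q)\<close>.\<close>
  have near: "\<forall>\<^sub>F n in sequentially. \<bar>x n - M\<bar> \<le> q ^ m * K + e / (1 - q)" if e: "e > 0" for e m
  proof (induction m)
    case 0
    have "\<bar>x n - M\<bar> \<le> K + e / (1 - q)" for n
    proof -
      have "e / (1 - q) > 0" using e q by simp
      then show ?thesis using bound[of n] unfolding K_def by linarith
    qed
    then show ?case by simp
  next
    case (Suc m)
    have 1: "\<forall>\<^sub>F n in sequentially. \<bar>x (n - k) - M\<bar> \<le> q ^ m * K + e / (1 - q)"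
      using eventually_compose_filterlim[OF Suc filterlim_minus_const_nat_at_top] .
    have 2: "\<forall>\<^sub>F n in sequentially. \<bar>y n - L\<bar> < e"
      using tendstoD[OF y e] by (simp add: dist_real_def)
    show ?case
      using 1 2 eventually_ge_at_top[of k]
    proof eventually_elim
      case (elim n)
      have "x n - M = q * (x (n - k) - M) + (y n - L)"
        using elim rec[of n] M by (simp add: algebra_simps)
      then have "\<bar>x n - M\<bar> \<le> q * \<bar>x (n - k) - M\<bar> + \<bar>y n - L\<bar>"
        using q by (metis abs_mult abs_of_nonneg abs_triangle_ineq)
      also have "\<dots> \<le> q * (q ^ m * K + e / (1 - q)) + e"
        using elim q by (intro add_mono mult_left_mono) auto
      also have "\<dots> = q ^ Suc m * K + e / (1 - q)"
        using q by (simp add: field_simps)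
      finally show ?case .
    qed
  qed
  have "x \<longlonglongrightarrow> M"
  proof (rule tendstoI)
    fix e :: real assume e: "e > 0"
    have "(\<lambda>m. q ^ m * K) \<longlonglongrightarrow> 0 * K"
      using q by (intro tendsto_intros LIMSEQ_realpow_zero) auto
    then have "\<forall>\<^sub>F m in sequentially. q ^ m * K < e / 2"
      using e by (intro order_tendstoD(2)) auto
    then obtain m where m: "q ^ m * K < e / 2"
      by (auto simp: eventually_sequentially)
    have "e * (1 - q) / 2 > 0" using e q by simp
    from near[OF this, of m] show "\<forall>\<^sub>F n in sequentially. dist (x n) M < e"
    proof eventually_elim
      case (elim n)
      have "e * (1 - q) / 2 / (1 - q) = e / 2" using q by (simp add: field_simps)
      then show ?case using elim m by (simp add: dist_real_def)
    qed
  qed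
  then show ?thesis by (simp add: M_def)
qed

text \<open>Multiplication of the generating function by \<open>(z / 2) ^ j\<close>: the effect of
  prepending a row of \<open>j\<close> dominoes when each domino has weight
  \<open>1 / 2\<close>.\<close>

definition shift :: "nat \<Rightarrow> (nat \<Rightarrow> real) \<Rightarrow> nat \<Rightarrow> real" where
  "shift j f n = (if j \<le> n then f (n - j) / 2 ^ j else 0)"

lemma shift_tendsto:
  assumes "f \<longlonglongrightarrow> L"
  shows "shift j f \<longlonglongrightarrow> L / 2 ^ j"
proof -
  have "(\<lambda>n. f (n - j) / 2 ^ j) \<longlonglongrightarrow> L / 2 ^ j"
    using filterlim_compose[OF assms filterlim_minus_const_nat_at_top] by (intro tendsto_intros) auto
  moreover have "\<forall>\<^sub>F n in sequentially. f (n - j) / 2 ^ j = shift j f n"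
    using eventually_ge_at_top[of j] by eventually_elim (simp add: shift_def)
  ultimately show ?thesis by (rule Lim_transform_eventually)
qed

lemma shift_tendsto_0: "f \<longlonglongrightarrow> 0 \<Longrightarrow> shift j f \<longlonglongrightarrow> 0"
  using shift_tendsto[of f 0 j] by simp

text \<open>\<open>c\<close> is the number of ways to repeat the length \<open>k\<close>. Below it
  is 1 or 2, so \<open>c < 2 ^ k\<close> fails only for \<open>c = 2\<close>, \<open>k = 1\<close>,
  the critical state.\<close>

lemma shift_recurrence_tendsto:
  assumes rec: "\<And>n. x n = c * shift k x n + y n"
    and k: "k \<ge> 1" and c: "0 \<le> c" "c < 2 ^ k" and y: "y \<longlonglongrightarrow> L"
  shows "x \<longlonglongrightarrow> L / (1 - c / 2 ^ k)"
  by (rule linear_recurrence_tendsto[OF _ k _ _ y])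
    (use c in \<open>auto simp: shift_def intro: trans[OF rec]\<close>)

section \<open>Towers as sequences of moves\<close>

text \<open>
  A move \<open>(a, j)\<close> from a row of length \<open>k\<close> adds a row of length \<open>j\<close> whose left border lies \<open>a\<close> cells
  further out; \<open>right_growth k a j\<close> is the corresponding displacement of the right border. The flags
  \<open>p\<close> and \<open>q\<close> record that the left and the right border, respectively, have retreated, and \<open>h\<close> that
  the length \<open>b\<close> has occurred.
\<close>

definition right_growth :: "nat \<Rightarrow> int \<Rightarrow> nat \<Rightarrow> int" where
  "right_growth k a j = 2 * (int j - int k) - a"

definition moves :: "nat \<Rightarrow> bool \<Rightarrow> bool \<Rightarrow> nat \<Rightarrow> (int \<times> nat) set" where
  "moves b p q k = {(a, j). 1 \<le> j \<and> j \<le> b \<and> a \<le> 1 \<and> right_growth k a j \<le> 1 \<and>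
    (p \<longrightarrow> a \<le> 0) \<and> (q \<longrightarrow> right_growth k a j \<le> 0)}"

text \<open>\<open>F\<close> is a condition on the flags after the last move; it selects all towers,
  the left-leaning ones or negligible ones from the same moves. The starting length does not set
  \<open>h\<close>, so for a bottom row the flag has to start as \<open>k = b\<close>.\<close>

fun run :: "nat \<Rightarrow> (bool \<Rightarrow> bool \<Rightarrow> bool \<Rightarrow> bool) \<Rightarrow>
    bool \<Rightarrow> bool \<Rightarrow> bool \<Rightarrow> nat \<Rightarrow> (int \<times> nat) list \<Rightarrow> bool" where
  "run b F p q h k [] \<longleftrightarrow> F p q h"
| "run b F p q h k ((a, j) # xs) \<longleftrightarrow> (a, j) \<in> moves b p q k \<and>
    run b F (p \<or> a < 0) (q \<or> right_growth k a j < 0) (h \<or> j = b) j xs"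

definition runs :: "nat \<Rightarrow> (bool \<Rightarrow> bool \<Rightarrow> bool \<Rightarrow> bool) \<Rightarrow>
    bool \<Rightarrow> bool \<Rightarrow> bool \<Rightarrow> nat \<Rightarrow> nat \<Rightarrow> (int \<times> nat) list set" where
  "runs b F p q h k n = {xs. run b F p q h k xs \<and> sum_list (map snd xs) = n}"

definition density :: "nat \<Rightarrow> (bool \<Rightarrow> bool \<Rightarrow> bool \<Rightarrow> bool) \<Rightarrow>
    bool \<Rightarrow> bool \<Rightarrow> bool \<Rightarrow> nat \<Rightarrow> nat \<Rightarrow> real" where
  "density b F p q h k n = real (card (runs b F p q h k n)) / 2 ^ n"

lemma finite_moves: "finite (moves b p q k)"
  by (rule finite_subset[of _ "{- 2 * int k - 1..1} \<times> {..b}"])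
    (auto simp: moves_def right_growth_def)

text \<open>Case distinction on the first move. The restriction \<open>snd s \<le> n\<close> keeps
  the truncated subtraction \<open>n - snd s\<close> from admitting moves that use too many
  dominoes.\<close>

lemma runs_rec:
  "runs b F p q h k n = (if n = 0 \<and> F p q h then {[]} else {}) \<union>
    (\<Union>s\<in>{s \<in> moves b p q k. snd s \<le> n}. (#) s ` runs b F (p \<or> fst s < 0)
      (q \<or> right_growth k (fst s) (snd s) < 0) (h \<or> snd s = b) (snd s) (n - snd s))"
  (is "?L = ?R")
proof (rule set_eqI)
  fix xs show "xs \<in> ?L \<longleftrightarrow> xs \<in> ?R"
    by (cases xs) (auto simp: runs_def image_iff)
qed

lemma finite_runs: "finite (runs b F p q h k n)"
proof (induction n arbitrary: p q h k rule: less_induct)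
  case (less n)
  then show ?case
    by (subst runs_rec, intro finite_UnI finite_UN_I finite_imageI less)
      (simp, simp add: finite_moves, auto simp: moves_def)
qed

lemma card_runs_rec:
  "card (runs b F p q h k n) = of_bool (n = 0 \<and> F p q h) +
    (\<Sum>(a, j)\<in>moves b p q k. if j \<le> n then
      card (runs b F (p \<or> a < 0) (q \<or> right_growth k a j < 0) (h \<or> j = b) j (n - j)) else 0)"
proof -
  let ?M = "{s \<in> moves b p q k. snd s \<le> n}"
  let ?R = "\<lambda>s. runs b F (p \<or> fst s < 0) (q \<or> right_growth k (fst s) (snd s) < 0)
    (h \<or> snd s = b) (snd s) (n - snd s)"
  have fin: "finite ?M" "finite (?R s)" for s
    by (auto simp: finite_moves finite_runs split: prod.split)
  have "card (runs b F p q h k n) = of_bool (n = 0 \<and> F p q h) + card (\<Union>s\<in>?M. (#) s ` ?R s)"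
    by (subst runs_rec, subst card_Un_disjoint) (auto simp: fin finite_runs)
  also have "card (\<Union>s\<in>?M. (#) s ` ?R s) = (\<Sum>s\<in>?M. card ((#) s ` ?R s))"
    by (rule card_UN_disjoint) (use fin in auto)
  also have "\<dots> = (\<Sum>s\<in>?M. card (?R s))"
    by (intro sum.cong refl card_image) auto
  also have "\<dots> = (\<Sum>s\<in>moves b p q k. if snd s \<le> n then card (?R s) else 0)"
    by (rule sum.mono_neutral_cong_left) (auto simp: finite_moves)
  finally show ?thesis
    by (simp add: split_def)
qed

lemma density_rec:
  "density b F p q h k n = of_bool (n = 0 \<and> F p q h) +
    (\<Sum>(a, j)\<in>moves b p q k.
      shift j (density b F (p \<or> a < 0) (q \<or> right_growth k a j < 0) (h \<or> j = b) j) n)"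
proof -
  have "real (if j \<le> n then m else 0) / 2 ^ n = (if j \<le> n then real m / 2 ^ (n - j) / 2 ^ j else 0)" for j m
    by (simp add: power_add[symmetric])
  then show ?thesis
    unfolding density_def shift_def
    by (subst card_runs_rec) (simp add: add_divide_distrib sum_divide_distrib split_def)
qed

section \<open>Restricting the flags at the end of a run\<close>

lemma run_True_left: "run b F True q h k xs \<Longrightarrow> \<exists>q h. F True q h"
  by (induction xs arbitrary: q h k) auto

lemma density_True_left_eq_0: "(\<And>q h. \<not> F True q h) \<Longrightarrow> density b F True q h k n = 0"
proof -
  assume "\<And>q h. \<not> F True q h"
  then have "runs b F True q h k n = {}"
    using run_True_left[of b F] by (auto simp: runs_def)
  then show ?thesis by (simp add: density_def)
qed

text \<open>A retreated right border forces \<open>2 * (j - k) \<le> a \<le> 1\<close>, hence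
  \<open>j \<le> k\<close>: the lengths can no longer rise to \<open>b\<close>.\<close>

lemma run_never_longest: "run b F p True False k xs \<Longrightarrow> k < b \<Longrightarrow> \<exists>p q. F p q False"
proof (induction xs arbitrary: p k)
  case (Cons s xs)
  obtain a j where s: "s = (a, j)" by fastforce
  have "(a, j) \<in> moves b p True k" using Cons.prems s by simp
  then have "j \<le> k" by (auto simp: moves_def right_growth_def)
  then show ?case using Cons s by (auto split: if_splits)
qed auto

lemma density_never_longest_eq_0:
  "(\<And>p q. \<not> F p q False) \<Longrightarrow> k < b \<Longrightarrow> density b F p True False k n = 0"
proof -
  assume "\<And>p q. \<not> F p q False" "k < b"
  then have "runs b F p True False k n = {}"
    using run_never_longest[of b F] by (auto simp: runs_def)
  then show ?thesis by (simp add: density_def)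
qed

text \<open>The final flags are determined by the starting state and the moves, so conditions on
  them combine like Boolean functions.\<close>

lemma run_conj:
  "run b (\<lambda>p q h. F p q h \<and> G p q h) p q h k xs \<longleftrightarrow> run b F p q h k xs \<and> run b G p q h k xs"
  by (induction b F p q h k xs rule: run.induct) auto

lemma run_conj_not:
  "run b (\<lambda>p q h. F p q h \<and> \<not> G p q h) p q h k xs \<longleftrightarrow> run b F p q h k xs \<and> \<not> run b G p q h k xs"
  by (induction b F p q h k xs rule: run.induct) auto

lemma density_split:
  "density b F p q h k n = density b (\<lambda>p q h. F p q h \<and> G p q h) p q h k n +
    density b (\<lambda>p q h. F p q h \<and> \<not> G p q h) p q h k n"
proof -
  let ?A = "runs b (\<lambda>p q h. F p q h \<and> G p q h) p q h k n"
  let ?B = "runs b (\<lambda>p q h. F p q h \<and> \<not> G p q h) p q h k n"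
  have "runs b F p q h k n = ?A \<union> ?B" "?A \<inter> ?B = {}"
    by (auto simp: runs_def run_conj[of b F G] run_conj_not[of b F G])
  then show ?thesis
    by (simp add: density_def card_Un_disjoint finite_runs add_divide_distrib)
qed

text \<open>Reflection in a vertical line exchanges the borders. On moves it replaces
  \<open>a\<close> by \<open>right_growth k a j\<close>, an involution because the two displacements
  have the fixed sum \<open>2 * (j - k)\<close>.\<close>

lemma density_mirror: "density b F p q h k n = density b (\<lambda>p q. F q p) q p h k n"
proof (induction n arbitrary: p q h k rule: less_induct)
  case (less n)
  have shift: "shift j (density b F p q h j) n = shift j (density b (\<lambda>p q. F q p) q p h j) n"
    if "j \<ge> 1" for j p q h
    using less[of "n - j"] that by (simp add: shift_def)
  show ?case
    unfolding density_rec[of b F p q h k n] density_rec[of b "\<lambda>p q. F q p" q p h k n]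
    by (intro arg_cong2[of _ _ _ _ "(+)"] refl sum.reindex_bij_witness
        [of _ "\<lambda>(a, j). (right_growth k a j, j)" "\<lambda>(a, j). (right_growth k a j, j)"])
      (auto simp: moves_def right_growth_def shift)
qed

section \<open>Limiting densities\<close>

lemma of_bool_tendsto_0: "(\<lambda>n. of_bool (n = 0 \<and> P) :: real) \<longlonglongrightarrow> 0"
proof (rule tendsto_eventually)
  show "\<forall>\<^sub>F n in sequentially. (of_bool (n = 0 \<and> P) :: real) = 0"
    using eventually_gt_at_top[of 0] by eventually_elim simp
qed

lemma density_both_tendsto_0:
  assumes "1 \<le> k" "k \<le> b" "k = b \<Longrightarrow> h"
  shows "density b F True True h k \<longlonglongrightarrow> 0"
  using assms
proof (induction k rule: less_induct)
  case (less k)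
  let ?M = "{(a, j) \<in> moves b True True k. j < k}"
  define y where "y n = of_bool (n = 0 \<and> F True True h) +
    (\<Sum>(a, j)\<in>?M. shift j (density b F True True h j) n)" for n
  have fin: "finite ?M" by (rule finite_subset[OF _ finite_moves]) auto
  \<comment> \<open>With both borders retreated, repeating the length requires
    \<open>a \<le> 0\<close> and \<open>- a \<le> 0\<close>, so there is one way, with factor
    \<open>1 / 2 ^ k < 1\<close>; all other moves shorten the row and are covered by
    induction.\<close>
  have mv: "moves b True True k = insert (0, k) ?M"
    using less.prems by (auto simp: moves_def right_growth_def)
  have rec: "density b F True True h k n = 1 * shift k (density b F True True h k) n + y n" for n
  proof -
    \<comment> \<open>No longer row follows, and \<open>h\<close> already holds if
      \<open>k = b\<close>, so the flag \<open>h\<close> stays constant.\<close>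
    have "(\<Sum>(a, j)\<in>?M. shift j (density b F True True (h \<or> j = b) j) n) =
        (\<Sum>(a, j)\<in>?M. shift j (density b F True True h j) n)"
      using less.prems by (intro sum.cong) auto
    moreover have "(h \<or> k = b) = h" using less.prems by auto
    ultimately show ?thesis
      by (subst density_rec, subst mv, subst sum.insert) (auto simp: fin y_def)
  qed
  have y: "y \<longlonglongrightarrow> 0 + 0"
    unfolding y_def
    using less by (intro tendsto_add of_bool_tendsto_0 tendsto_null_sum) (auto intro!: shift_tendsto_0 simp: moves_def)
  have "density b F True True h k \<longlonglongrightarrow> (0 + 0) / (1 - 1 / 2 ^ k)"
    by (rule shift_recurrence_tendsto[OF rec _ _ _ y]) (use less.prems in auto)
  then show ?case by simp
qed

text \<open>Only the right border is bound, so a repetition may keep the left border or advance it: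
  \<open>a = 0\<close> or \<open>a = 1\<close>. This is the factor 2 in the recurrence.\<close>

lemma moves_drift:
  assumes "1 \<le> k" "k \<le> b"
  shows "moves b False True k = insert (0, k) (insert (1, k) {(a, j) \<in> moves b False True k. j < k})"
  using assms by (auto simp: moves_def right_growth_def)

lemma density_drift_rec:
  assumes "1 \<le> k" "k \<le> b" "k = b \<Longrightarrow> h"
  shows "density b F False True h k n = 2 * shift k (density b F False True h k) n +
    (of_bool (n = 0 \<and> F False True h) +
     (\<Sum>(a, j)\<in>{(a, j) \<in> moves b False True k. j < k}. shift j (density b F (a < 0) True h j) n))"
proof -
  let ?M = "{(a, j) \<in> moves b False True k. j < k}"
  have fin: "finite ?M" by (rule finite_subset[OF _ finite_moves]) auto
  have "(\<Sum>(a, j)\<in>?M. shift j (density b F (a < 0) True (h \<or> j = b) j) n) =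
      (\<Sum>(a, j)\<in>?M. shift j (density b F (a < 0) True h j) n)"
    using assms by (intro sum.cong) auto
  moreover have "(h \<or> k = b) = h" using assms by auto
  ultimately show ?thesis
    by (subst density_rec, subst moves_drift[OF assms(1,2)], subst sum.insert, (auto simp: fin)[2])
      (subst sum.insert, auto simp: fin)
qed

text \<open>For \<open>k = 1\<close> the factor \<open>2 / 2 ^ k\<close> is 1 and damps nothing: the
  recurrence copies the value at \<open>n = 0\<close>, which is 0 because \<open>F\<close> rejects
  the state. No shorter row exists to feed it.\<close>

lemma density_drift_unit_eq_0:
  assumes "1 \<le> b" "b = 1 \<Longrightarrow> h" "\<not> F False True h"
  shows "density b F False True h 1 n = 0"
proof (induction n rule: less_induct)
  case (less n)
  have none: "{(a, j) \<in> moves b False True 1. j < 1} = {}"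
    by (auto simp: moves_def)
  have "density b F False True h 1 n = 2 * shift 1 (density b F False True h 1) n +
      (of_bool (n = 0 \<and> F False True h) +
       (\<Sum>(a, j)\<in>{(a, j) \<in> moves b False True 1. j < 1}. shift j (density b F (a < 0) True h j) n))"
    using assms by (intro density_drift_rec) auto
  also have "\<dots> = 2 * shift 1 (density b F False True h 1) n"
    unfolding none using assms by simp
  also have "\<dots> = 0"
    using less[of "n - 1"] by (simp add: shift_def)
  finally show ?case .
qed

text \<open>For \<open>k \<ge> 2\<close> the factor \<open>2 / 2 ^ k\<close> is below 1 and all
  inputs come from shorter rows: they vanish by induction while the left border is free, and by the
  previous limit once both have retreated. The undamped length 1 is settled exactly.\<close>

lemma density_drift_tendsto_0:
  assumes "1 \<le> k" "k \<le> b" "k = b \<Longrightarrow> h" "\<not> F False True h"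
  shows "density b F False True h k \<longlonglongrightarrow> 0"
  using assms
proof (induction k rule: less_induct)
  case (less k)
  show ?case
  proof (cases "k = 1")
    case True
    then have "density b F False True h k n = 0" for n
      using density_drift_unit_eq_0[of b h F n] less.prems by auto
    then show ?thesis by simp
  next
    case False
    have y: "(\<lambda>n. of_bool (n = 0 \<and> F False True h) +
     (\<Sum>(a, j)\<in>{(a, j) \<in> moves b False True k. j < k}. shift j (density b F (a < 0) True h j) n))
      \<longlonglongrightarrow> 0 + 0"
    proof (intro tendsto_add of_bool_tendsto_0 tendsto_null_sum)
      fix s assume s: "s \<in> {(a, j) \<in> moves b False True k. j < k}"
      then obtain a j where aj: "s = (a, j)" "1 \<le> j" "j < k" by (auto simp: moves_def)
      then have "density b F (a < 0) True h j \<longlonglongrightarrow> 0"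
        using less density_both_tendsto_0[of j b h F] by (cases "a < 0") auto
      then show "(\<lambda>n. case s of (a, j) \<Rightarrow> shift j (density b F (a < 0) True h j) n) \<longlonglongrightarrow> 0"
        using aj by (auto intro!: shift_tendsto_0)
    qed
    have "(2::real) < 2 ^ k"
      using power_strict_increasing[of 1 k "2::real"] False less.prems by simp
    then have "density b F False True h k \<longlonglongrightarrow> (0 + 0) / (1 - 2 / 2 ^ k)"
      using less.prems
      by (intro shift_recurrence_tendsto[OF density_drift_rec _ _ _ y]) auto
    then show ?thesis by simp
  qed
qed

lemma density_growth_rec:
  assumes "1 \<le> k" "k \<le> b" "k = b \<Longrightarrow> h"
  shows "density b F False False h k n = 1 * shift k (density b F False False h k) n +
    (of_bool (n = 0 \<and> F False False h) +
     (if k < b then shift (Suc k) (density b F False False (h \<or> Suc k = b) (Suc k)) n else 0) +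
     (\<Sum>(a, j)\<in>{(a, j) \<in> moves b False False k. a < 0 \<or> right_growth k a j < 0}.
        shift j (density b F (a < 0) (right_growth k a j < 0) h j) n))"
proof -
  let ?T = "{(a, j) \<in> moves b False False k. a < 0 \<or> right_growth k a j < 0}"
  let ?U = "if k < b then {(1, Suc k)} else {}"
  let ?f = "\<lambda>(a, j). shift j (density b F (False \<or> a < 0) (False \<or> right_growth k a j < 0) (h \<or> j = b) j) n"
  have straight: "right_growth k 0 k = 0" "right_growth k 1 (Suc k) = 1"
    by (auto simp: right_growth_def)
  have fin: "finite ?T" by (rule finite_subset[OF _ finite_moves]) auto
  have mv: "moves b False False k = insert (0, k) (?U \<union> ?T)"
  proof (rule set_eqI)
    fix s :: "int \<times> nat"
    obtain a j where s: "s = (a, j)" by fastforce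
    \<comment> \<open>Parity: the displacements add up to \<open>2 * (j - k)\<close>, so if both lie
      in \<open>{0, 1}\<close> they are equal. Without retreat a row is either repeated or extended
      by one cell on each side.\<close>
    have "a = 0 \<and> j = k \<or> a = 1 \<and> j = Suc k"
      if "0 \<le> a" "a \<le> 1" "0 \<le> right_growth k a j" "right_growth k a j \<le> 1"
      using that unfolding right_growth_def by presburger
    then have "s \<in> insert (0, k) (?U \<union> ?T)" if "s \<in> moves b False False k"
      using that by (cases "a < 0 \<or> right_growth k a j < 0") (force simp: s moves_def)+
    moreover have "s \<in> moves b False False k" if "s \<in> insert (0, k) (?U \<union> ?T)"
      using that assms by (auto simp: moves_def right_growth_def split: if_splits)
    ultimately show "s \<in> moves b False False k \<longleftrightarrow> s \<in> insert (0, k) (?U \<union> ?T)"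
      by blast
  qed
  have "sum ?f (moves b False False k) = ?f (0, k) + sum ?f (?U \<union> ?T)"
    by (subst mv, subst sum.insert) (auto simp: fin straight)
  also have "sum ?f (?U \<union> ?T) = sum ?f ?U + sum ?f ?T"
    by (subst sum.union_disjoint) (auto simp: fin straight)
  also have "sum ?f ?U = (if k < b then shift (Suc k) (density b F False False (h \<or> Suc k = b) (Suc k)) n else 0)"
    by (simp add: straight)
  also have "sum ?f ?T = (\<Sum>(a, j)\<in>?T. shift j (density b F (a < 0) (right_growth k a j < 0) h j) n)"
  proof (rule sum.cong[OF refl])
    fix s assume s: "s \<in> ?T"
    obtain a j where aj: "s = (a, j)" by fastforce
    have "j \<le> k" using s aj by (auto simp: moves_def right_growth_def)
    then have "(h \<or> j = b) = h" using assms by auto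
    then show "?f s = (case s of (a, j) \<Rightarrow> shift j (density b F (a < 0) (right_growth k a j < 0) h j) n)"
      by (simp add: aj)
  qed
  also have "?f (0, k) = shift k (density b F False False h k) n"
  proof -
    have "(h \<or> k = b) = h" using assms by auto
    then show ?thesis by (simp add: straight)
  qed
  finally show ?thesis
    by (subst density_rec) simp
qed

text \<open>Extension leads to length \<open>Suc k\<close>, hence the induction on
  \<open>b - k\<close>. Repetition has one way, and a retreat enters a state already known to
  vanish, since \<open>F\<close> rejects towers with exactly one retreated border.\<close>

lemma density_growth_tendsto_0:
  assumes "1 \<le> k" "k \<le> b" "k = b \<Longrightarrow> h" "\<And>h. \<not> F False True h" "\<And>h. \<not> F True False h"
  shows "density b F False False h k \<longlonglongrightarrow> 0"
  using assms
proof (induction "b - k" arbitrary: k h rule: less_induct)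
  case less
  let ?T = "{(a, j) \<in> moves b False False k. a < 0 \<or> right_growth k a j < 0}"
  have y: "(\<lambda>n. of_bool (n = 0 \<and> F False False h) +
     (if k < b then shift (Suc k) (density b F False False (h \<or> Suc k = b) (Suc k)) n else 0) +
     (\<Sum>(a, j)\<in>?T. shift j (density b F (a < 0) (right_growth k a j < 0) h j) n)) \<longlonglongrightarrow> 0 + 0 + 0"
  proof (intro tendsto_add of_bool_tendsto_0 tendsto_null_sum)
    show "(\<lambda>n. if k < b then shift (Suc k) (density b F False False (h \<or> Suc k = b) (Suc k)) n else 0) \<longlonglongrightarrow> 0"
      using less.hyps[of "Suc k" "h \<or> Suc k = b"] less.prems
      by (cases "k < b") (auto intro!: shift_tendsto_0)
    fix s assume s: "s \<in> ?T"
    obtain a j where aj: "s = (a, j)" by fastforce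
    have j: "1 \<le> j" "j \<le> k" "a < 0 \<or> right_growth k a j < 0"
      using s aj by (auto simp: moves_def right_growth_def)
    have "density b F (a < 0) (right_growth k a j < 0) h j \<longlonglongrightarrow> 0"
    proof (cases "a < 0"; cases "right_growth k a j < 0")
      \<comment> \<open>Only the left border has retreated; reflection reduces this to the right
        border.\<close>
      assume c: "a < 0" "\<not> right_growth k a j < 0"
      have "density b (\<lambda>p q. F q p) False True h j \<longlonglongrightarrow> 0"
        using j less.prems by (intro density_drift_tendsto_0) auto
      then show ?thesis
        using c by (simp add: density_mirror[of b F True False, abs_def])
    qed (use j less.prems in \<open>auto intro!: density_both_tendsto_0 density_drift_tendsto_0\<close>)
    then show "(\<lambda>n. case s of (a, j) \<Rightarrow> shift j (density b F (a < 0) (right_growth k a j < 0) h j) n) \<longlonglongrightarrow> 0"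
      using aj by (auto intro!: shift_tendsto_0)
  qed
  have "(1::real) < 2 ^ k" using less.prems by simp
  then have "density b F False False h k \<longlonglongrightarrow> (0 + 0 + 0) / (1 - 1 / 2 ^ k)"
    using less.prems by (intro shift_recurrence_tendsto[OF density_growth_rec _ _ _ y]) auto
  then show ?case by simp
qed

section \<open>Leaning towers, the surviving contribution\<close>

abbreviation left_leaning :: "bool \<Rightarrow> bool \<Rightarrow> bool \<Rightarrow> bool" where
  "left_leaning \<equiv> \<lambda>p q h. h \<and> \<not> p"

text \<open>A move with \<open>a < 0\<close> sets \<open>p\<close> for good and so contributes 0.
  Otherwise \<open>a\<close> is 0 or 1, and either value goes with every length up to
  \<open>k\<close>, since the right border then does not advance.\<close>

lemma density_left_rec:
  assumes "k \<le> b"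
  shows "density b left_leaning False True True k n =
    of_bool (n = 0) + 2 * (\<Sum>j=1..k. shift j (density b left_leaning False True True j) n)"
proof -
  let ?f = "\<lambda>(a::int, j). shift j (density b left_leaning (a < 0) True True j) n"
  have "(\<Sum>s\<in>moves b False True k. ?f s) = (\<Sum>s\<in>{0, 1} \<times> {1..k}. ?f s)"
  proof (rule sum.mono_neutral_right)
    show "{0, 1} \<times> {1..k} \<subseteq> moves b False True k"
      using assms by (auto simp: moves_def right_growth_def)
    show "\<forall>s\<in>moves b False True k - {0, 1} \<times> {1..k}. ?f s = 0"
    proof
      fix s assume s: "s \<in> moves b False True k - {0, 1} \<times> {1..k}"
      obtain a j where aj: "s = (a, j)" by fastforce
      have "a < 0" using s aj by (auto simp: moves_def right_growth_def)
      then show "?f s = 0"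
        by (simp add: aj shift_def density_True_left_eq_0)
    qed
  qed (rule finite_moves)
  also have "\<dots> = 2 * (\<Sum>j=1..k. shift j (density b left_leaning False True True j) n)"
    by (simp add: sum.cartesian_product[symmetric])
  finally show ?thesis
    by (subst density_rec) simp
qed

text \<open>Subtracting the recurrences of consecutive lengths removes the sum over shorter rows and
  leaves the density for \<open>k\<close> as input for \<open>Suc k\<close>, with factor
  \<open>2 / 2 ^ Suc k\<close>. The start is the critical length 1, whose density is constantly
  1.\<close>

lemma density_left_tendsto:
  assumes "1 \<le> k" "k \<le> b"
  shows "density b left_leaning False True True k \<longlonglongrightarrow> (\<Prod>i=1..k-1. 2 ^ i / (2 ^ i - 1))"
  using assms
proof (induction k rule: dec_induct)
  case base
  have "density b left_leaning False True True 1 n = 1" for n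
  proof (induction n rule: less_induct)
    case (less n)
    show ?case
      using assms less[of "n - 1"] density_left_rec[of 1 b n] by (auto simp: shift_def)
  qed
  then show ?case by simp
next
  case (step k)
  have rec: "density b left_leaning False True True (Suc k) n =
      2 * shift (Suc k) (density b left_leaning False True True (Suc k)) n +
      density b left_leaning False True True k n" for n
    using density_left_rec[of k b n] density_left_rec[of "Suc k" b n] step.prems by simp
  have "density b left_leaning False True True (Suc k) \<longlonglongrightarrow>
      (\<Prod>i=1..k-1. 2 ^ i / (2 ^ i - 1)) / (1 - 2 / 2 ^ Suc k)"
    by (rule shift_recurrence_tendsto[OF rec]) (use step in auto)
  moreover have "1 - 2 / 2 ^ Suc k = ((2 ^ k - 1) / 2 ^ k :: real)"
    by (simp add: field_simps)
  moreover have "(\<Prod>i=1..k. 2 ^ i / (2 ^ i - 1) :: real) = (\<Prod>i=1..k-1. 2 ^ i / (2 ^ i - 1)) * (2 ^ k / (2 ^ k - 1))"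
    using step.hyps by (cases k) auto
  ultimately show ?case by simp
qed

text \<open>
  From a row of the maximal length \<open>b\<close> the right border can advance only if the left one retreats, so
  the flag \<open>q\<close> is irrelevant for left-leaning towers.
\<close>

lemma density_left_longest:
  "density b left_leaning False False True b n = density b left_leaning False True True b n"
proof (induction n rule: less_induct)
  case (less n)
  let ?f = "\<lambda>q (a, j). shift j (density b left_leaning (False \<or> a < 0) (q \<or> right_growth b a j < 0) (True \<or> j = b) j) n"
  have zero: "?f q (a, j) = 0" if "a < 0" for q a j
    using that by (simp add: shift_def density_True_left_eq_0)
  have "sum (?f False) (moves b False False b) = sum (?f False) {(a, j) \<in> moves b False False b. 0 \<le> a}"
  proof (rule sum.mono_neutral_right)
    show "\<forall>s\<in>moves b False False b - {(a, j) \<in> moves b False False b. 0 \<le> a}. ?f False s = 0"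
    proof
      fix s assume s: "s \<in> moves b False False b - {(a, j) \<in> moves b False False b. 0 \<le> a}"
      obtain a j where aj: "s = (a, j)" by fastforce
      have "a < 0" using s aj by auto
      then show "?f False s = 0" unfolding aj by (rule zero)
    qed
  qed (auto simp: finite_moves)
  also have "\<dots> = sum (?f True) {(a, j) \<in> moves b False True b. 0 \<le> a}"
  proof (rule sum.cong)
    show "{(a, j) \<in> moves b False False b. 0 \<le> a} = {(a, j) \<in> moves b False True b. 0 \<le> a}"
      by (auto simp: moves_def right_growth_def)
    fix s assume s: "s \<in> {(a, j) \<in> moves b False True b. 0 \<le> a}"
    obtain a j where aj: "s = (a, j)" by fastforce
    show "?f False s = ?f True s"
    proof (cases "right_growth b a j < 0")
      case False
      \<comment> \<open>Without retreat on the right, \<open>0 \<le> a\<close> leaves only the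
        repetition of the row, and the claim for \<open>n - b\<close> applies.\<close>
      then have "a = 0" "j = b" "1 \<le> b"
        using s aj by (auto simp: moves_def right_growth_def)
      then show ?thesis
        using less[of "n - b"] by (simp add: aj shift_def right_growth_def)
    qed (simp add: aj)
  qed
  also have "\<dots> = sum (?f True) (moves b False True b)"
  proof (rule sum.mono_neutral_left)
    show "\<forall>s\<in>moves b False True b - {(a, j) \<in> moves b False True b. 0 \<le> a}. ?f True s = 0"
    proof
      fix s assume s: "s \<in> moves b False True b - {(a, j) \<in> moves b False True b. 0 \<le> a}"
      obtain a j where aj: "s = (a, j)" by fastforce
      have "a < 0" using s aj by auto
      then show "?f True s = 0" unfolding aj by (rule zero)
    qed
  qed (auto simp: finite_moves)
  finally show ?case
    unfolding density_rec[of b left_leaning False False True b n]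
      density_rec[of b left_leaning False True True b n]
    by simp
qed

text \<open>Before \<open>b\<close> has occurred any retreat is fatal: on the left by the condition
  \<open>\<not> p\<close>, on the right because the lengths can then no longer reach
  \<open>b\<close>. Only repetition and extension remain.\<close>

lemma density_left_growth_rec:
  assumes "1 \<le> k" "k < b"
  shows "density b left_leaning False False False k n =
    1 * shift k (density b left_leaning False False False k) n +
    shift (Suc k) (density b left_leaning False False (Suc k = b) (Suc k)) n"
proof -
  let ?T = "{(a, j) \<in> moves b False False k. a < 0 \<or> right_growth k a j < 0}"
  let ?f = "\<lambda>(a, j). shift j (density b left_leaning (a < 0) (right_growth k a j < 0) False j) n"
  have "sum ?f ?T = 0"
  proof (rule sum.neutral, rule ballI)
    fix s assume s: "s \<in> ?T"
    obtain a j where aj: "s = (a, j)" by fastforce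
    have "j < b" using s aj assms by (auto simp: moves_def right_growth_def)
    then show "?f s = 0"
      using s by (cases "a < 0") (auto simp: aj shift_def density_True_left_eq_0 density_never_longest_eq_0)
  qed
  then show ?thesis
    using assms by (subst density_growth_rec) auto
qed

text \<open>Downward induction from \<open>b\<close>, where the way down is already evaluated.
  Repeating \<open>k\<close> and extending it to \<open>Suc k\<close> contribute
  \<open>1 / (1 - 1 / 2 ^ k)\<close> and \<open>1 / 2 ^ Suc k\<close>; with \<open>2 ^ k\<close>
  split off, the rest changes by \<open>1 / (2 ^ k - 1)\<close>.\<close>

lemma density_left_growth_tendsto:
  assumes "1 \<le> k" "k \<le> b"
  shows "density b left_leaning False False (k = b) k \<longlonglongrightarrow>
    2 ^ k * ((\<Prod>i=1..b-1. 2 ^ i / (2 ^ i - 1)) / 2 ^ b / (\<Prod>i=k..b-1. 2 ^ i - 1))"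
  using assms(2,1)
proof (induction k rule: inc_induct)
  case base
  have "density b left_leaning False False True b = density b left_leaning False True True b"
    by (rule ext) (rule density_left_longest)
  then show ?case
    using base density_left_tendsto[of b b] by simp
next
  case (step k)
  let ?c = "(\<Prod>i=1..b-1. 2 ^ i / (2 ^ i - 1)) / 2 ^ b :: real"
  have "density b left_leaning False False (Suc k = b) (Suc k)
      \<longlonglongrightarrow> 2 ^ Suc k * (?c / (\<Prod>i=Suc k..b-1. 2 ^ i - 1))"
    using step by simp
  then have "shift (Suc k) (density b left_leaning False False (Suc k = b) (Suc k))
      \<longlonglongrightarrow> 2 ^ Suc k * (?c / (\<Prod>i=Suc k..b-1. 2 ^ i - 1)) / 2 ^ Suc k"
    by (rule shift_tendsto)
  then have "shift (Suc k) (density b left_leaning False False (Suc k = b) (Suc k))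
      \<longlonglongrightarrow> ?c / (\<Prod>i=Suc k..b-1. 2 ^ i - 1)"
    by simp
  then have "density b left_leaning False False False k
      \<longlonglongrightarrow> ?c / (\<Prod>i=Suc k..b-1. 2 ^ i - 1) / (1 - 1 / 2 ^ k)"
    by (rule shift_recurrence_tendsto[OF density_left_growth_rec, rotated -1]) (use step in auto)
  moreover have "(\<Prod>i=k..b-1. 2 ^ i - 1 :: real) = (2 ^ k - 1) * (\<Prod>i=Suc k..b-1. 2 ^ i - 1)"
    using step by (intro prod.atLeast_Suc_atMost) auto
  moreover have "x / (1 - 1 / 2 ^ k) = 2 ^ k * (x / (2 ^ k - 1))" for x :: real
    by (simp add: field_simps)
  ultimately show ?case
    using step by (simp add: mult_ac)
qed

text \<open>Towers with equal flags are negligible; those with different flags form two mirror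
  images. Either half agrees with \<open>left_leaning\<close> up to the negligible towers without
  retreat, which \<open>\<not> p\<close> also admits; hence the factor 2.\<close>

lemma density_longest_tendsto:
  assumes "1 \<le> k" "k \<le> b"
  shows "density b (\<lambda>p q h. h) False False (k = b) k \<longlonglongrightarrow>
    2 * (2 ^ k * ((\<Prod>i=1..b-1. 2 ^ i / (2 ^ i - 1)) / 2 ^ b / (\<Prod>i=k..b-1. 2 ^ i - 1)))"
proof -
  let ?d = "\<lambda>F. density b F False False (k = b) k"
  let ?L = "2 ^ k * ((\<Prod>i=1..b-1. 2 ^ i / (2 ^ i - 1)) / 2 ^ b / (\<Prod>i=k..b-1. 2 ^ i - 1)) :: real"
  have "?d left_leaning n = ?d (\<lambda>p q h. h \<and> \<not> p \<and> q) n + ?d (\<lambda>p q h. h \<and> \<not> p \<and> \<not> q) n" for n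
    using density_split[of b left_leaning False False "k = b" k n "\<lambda>p q h. q"] by simp
  then have left: "?d (\<lambda>p q h. h \<and> \<not> p \<and> q) n = ?d left_leaning n - ?d (\<lambda>p q h. h \<and> \<not> p \<and> \<not> q) n" for n
    by (simp add: algebra_simps)
  have mirror: "?d (\<lambda>p q h. h \<and> p \<and> \<not> q) n = ?d (\<lambda>p q h. h \<and> \<not> p \<and> q) n" for n
    using density_mirror[of b "\<lambda>p q h. h \<and> p \<and> \<not> q" False False "k = b" k n] by (simp add: conj_commute)
  have restrict: "(\<lambda>p q h. (h \<and> p \<noteq> q) \<and> q) = (\<lambda>p q h. h \<and> \<not> p \<and> q)"
    "(\<lambda>p q h. (h \<and> p \<noteq> q) \<and> \<not> q) = (\<lambda>p q h. h \<and> p \<and> \<not> q)"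
    by (auto simp: fun_eq_iff)
  have "?d (\<lambda>p q h. h) n = ?d (\<lambda>p q h. h \<and> p = q) n + ?d (\<lambda>p q h. h \<and> p \<noteq> q) n" for n
    by (rule density_split)
  moreover have "?d (\<lambda>p q h. h \<and> p \<noteq> q) n = ?d (\<lambda>p q h. h \<and> \<not> p \<and> q) n + ?d (\<lambda>p q h. h \<and> p \<and> \<not> q) n" for n
    using density_split[of b "\<lambda>p q h. h \<and> p \<noteq> q" False False "k = b" k n "\<lambda>p q h. q"]
    by (simp only: restrict)
  ultimately have eq: "?d (\<lambda>p q h. h) = (\<lambda>n. ?d (\<lambda>p q h. h \<and> p = q) n +
      2 * (?d left_leaning n - ?d (\<lambda>p q h. h \<and> \<not> p \<and> \<not> q) n))"
    unfolding mirror left by (simp add: fun_eq_iff)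
  have "?d (\<lambda>p q h. h \<and> p = q) \<longlonglongrightarrow> 0" "?d (\<lambda>p q h. h \<and> \<not> p \<and> \<not> q) \<longlonglongrightarrow> 0"
    using assms by (auto intro!: density_growth_tendsto_0)
  then have "(\<lambda>n. ?d (\<lambda>p q h. h \<and> p = q) n +
      2 * (?d left_leaning n - ?d (\<lambda>p q h. h \<and> \<not> p \<and> \<not> q) n)) \<longlonglongrightarrow> 0 + 2 * (?L - 0)"
    using density_left_growth_tendsto[OF assms] by (intro tendsto_intros)
  then show ?thesis unfolding eq by simp
qed

lemma runs_total_asymptotics:
  assumes b: "b \<ge> 1"
    and c: "\<And>n. c n = (\<Sum>k=1..b. if k \<le> n then card (runs b (\<lambda>p q h. h) False False (k = b) k (n - k)) else 0)"
  shows "(\<lambda>n. real (c n)) \<sim>[sequentially]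
    (\<lambda>n. 2 powi (int n - int b + 1) * (\<Prod>k=1..b-1. 2 ^ k / (2 ^ k - 1)) *
      (1 + (\<Sum>i\<in>{0..<b-1}. 1 / (\<Prod>k=i+1..b-1. (2 ^ k - 1)))))"
proof -
  let ?P = "(\<Prod>k=1..b-1. 2 ^ k / (2 ^ k - 1)) :: real"
  let ?S = "1 + (\<Sum>i\<in>{0..<b-1}. 1 / (\<Prod>k=i+1..b-1. (2 ^ k - 1))) :: real"
  have "real (if k \<le> n then m else 0) / 2 ^ n = (if k \<le> n then real m / 2 ^ (n - k) / 2 ^ k else 0)" for k m n
    by (simp add: power_add[symmetric])
  then have "real (c n) / 2 ^ n = (\<Sum>k=1..b. shift k (density b (\<lambda>p q h. h) False False (k = b) k) n)" for n
    by (simp only: c of_nat_sum sum_divide_distrib shift_def density_def)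
  moreover have "(\<lambda>n. \<Sum>k=1..b. shift k (density b (\<lambda>p q h. h) False False (k = b) k) n)
      \<longlonglongrightarrow> (\<Sum>k=1..b. 2 * (2 ^ k * (?P / 2 ^ b / (\<Prod>i=k..b-1. 2 ^ i - 1))) / 2 ^ k)"
    by (intro tendsto_sum shift_tendsto density_longest_tendsto) auto
  moreover have "(\<Sum>k=1..b. 2 * (2 ^ k * (?P / 2 ^ b / (\<Prod>i=k..b-1. 2 ^ i - 1))) / 2 ^ k) = 2 / 2 ^ b * ?P * ?S"
  proof -
    have "(\<Sum>k=1..b. 2 * (2 ^ k * (?P / 2 ^ b / (\<Prod>i=k..b-1. 2 ^ i - 1))) / 2 ^ k) =
        2 / 2 ^ b * ?P * (\<Sum>k=1..b. 1 / (\<Prod>i=k..b-1. 2 ^ i - 1))"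
      by (simp add: sum_distrib_left)
    \<comment> \<open>A bottom row of length \<open>b\<close> gives the empty product and so the
      summand 1; one of length \<open>k < b\<close> gives the summand with
      \<open>i = k - 1\<close>.\<close>
    also have "(\<Sum>k=1..b. 1 / (\<Prod>i=k..b-1. 2 ^ i - 1) :: real) =
        1 + (\<Sum>k=1..b-1. 1 / (\<Prod>i=k..b-1. 2 ^ i - 1))"
      using b by (cases b) auto
    also have "(\<Sum>k=1..b-1. 1 / (\<Prod>i=k..b-1. 2 ^ i - 1) :: real) =
        (\<Sum>i\<in>{0..<b-1}. 1 / (\<Prod>k=i+1..b-1. (2 ^ k - 1)))"
      by (rule sum.reindex_bij_witness[of _ "\<lambda>i. i + 1" "\<lambda>k. k - 1"]) auto
    finally show ?thesis .
  qed
  ultimately have lim: "(\<lambda>n. real (c n) / 2 ^ n) \<longlonglongrightarrow> 2 / 2 ^ b * ?P * ?S"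
    by simp
  have "?P > 0"
    by (intro prod_pos) (auto simp: one_less_power)
  moreover have "(\<Sum>i\<in>{0..<b-1}. 1 / (\<Prod>k=i+1..b-1. (2 ^ k - 1)) :: real) \<ge> 0"
    by (intro sum_nonneg divide_nonneg_nonneg prod_nonneg) auto
  ultimately have pos: "2 / 2 ^ b * ?P * ?S > 0"
    by (intro mult_pos_pos) (auto intro: add_pos_nonneg)
  define Q where "Q = 2 / 2 ^ b * ?P * ?S"
  have Q: "Q > 0" unfolding Q_def by (rule pos)
  have "(\<lambda>n. real (c n) / 2 ^ n / Q) \<longlonglongrightarrow> Q / Q"
    using Q lim unfolding Q_def[symmetric] by (intro tendsto_divide tendsto_const) auto
  moreover have "Q / Q = 1"
    using Q by simp
  moreover have "2 powi (int n - int b + 1) * ?P * ?S = 2 ^ n * Q" for n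
    by (simp add: Q_def power_int_add power_int_diff)
  ultimately show ?thesis
    by (intro asymp_equivI') simp
qed

section \<open>The polyomino of a sequence of moves\<close>

definition strip :: "int \<Rightarrow> nat \<Rightarrow> int \<Rightarrow> cell set" where
  "strip l k y = {l..<l + 2 * int k} \<times> {y}"

lemma finite_strip: "finite (strip l k y)"
  by (simp add: strip_def)

lemma card_strip: "card (strip l k y) = 2 * k"
  by (simp add: strip_def card_cartesian_product nat_mult_distrib)

lemma strip_translate: "(\<lambda>(x, y). (x + dx, y + dy)) ` strip l k y = strip (l + dx) k (y + dy)"
proof (intro equalityI subsetI)
  fix c assume "c \<in> strip (l + dx) k (y + dy)"
  then have "(fst c - dx, snd c - dy) \<in> strip l k y" by (auto simp: strip_def)
  moreover have "c = (\<lambda>(x, y). (x + dx, y + dy)) (fst c - dx, snd c - dy)" by simp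
  ultimately show "c \<in> (\<lambda>(x, y). (x + dx, y + dy)) ` strip l k y" by blast
qed (auto simp: strip_def)

fun stack :: "int \<Rightarrow> nat \<Rightarrow> int \<Rightarrow> (int \<times> nat) list \<Rightarrow> cell set" where
  "stack l k y [] = strip l k y"
| "stack l k y ((a, j) # xs) = strip l k y \<union> stack (l - a) j (y + 1) xs"

text \<open>The support condition alone: an overhang of at most one cell on either side. It is kept
  apart from \<open>bitonic\<close>, which will express convexity of the columns.\<close>

fun climbs :: "nat \<Rightarrow> (int \<times> nat) list \<Rightarrow> bool" where
  "climbs k [] \<longleftrightarrow> True"
| "climbs k ((a, j) # xs) \<longleftrightarrow> 1 \<le> j \<and> a \<le> 1 \<and> right_growth k a j \<le> 1 \<and> climbs j xs"

fun bitonic :: "bool \<Rightarrow> bool \<Rightarrow> nat \<Rightarrow> (int \<times> nat) list \<Rightarrow> bool" where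
  "bitonic p q k [] \<longleftrightarrow> True"
| "bitonic p q k ((a, j) # xs) \<longleftrightarrow> (p \<longrightarrow> a \<le> 0) \<and> (q \<longrightarrow> right_growth k a j \<le> 0) \<and>
    bitonic (p \<or> a < 0) (q \<or> right_growth k a j < 0) j xs"

lemma run_iff_climbs_bitonic:
  "run b (\<lambda>p q h. h) p q h k xs \<longleftrightarrow> climbs k xs \<and> bitonic p q k xs \<and>
    (\<forall>s\<in>set xs. snd s \<le> b) \<and> (h \<or> b \<in> snd ` set xs)"
proof (induction xs arbitrary: p q h k)
  case (Cons s xs)
  obtain a j where s: "s = (a, j)" by fastforce
  show ?case
    unfolding s run.simps climbs.simps bitonic.simps Cons.IH by (simp add: moves_def) blast
qed simp

lemma stack_above: "(x, y') \<in> stack l k y xs \<Longrightarrow> y \<le> y'"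
  by (induction l k y xs rule: stack.induct) (auto simp: strip_def)

lemma stack_bottom_iff: "(x, y) \<in> stack l k y xs \<longleftrightarrow> l \<le> x \<and> x < l + 2 * int k"
proof (cases xs)
  case (Cons s xs')
  then show ?thesis
    using stack_above[of x y "l - fst s" "snd s" "y + 1" xs'] by (cases s) (auto simp: strip_def)
qed (auto simp: strip_def)

lemma strip_subset_stack: "strip l k y \<subseteq> stack l k y xs"
  by (cases "(l, k, y, xs)" rule: stack.cases) auto

lemma finite_stack: "finite (stack l k y xs)"
  by (induction l k y xs rule: stack.induct) (auto simp: finite_strip)

lemma card_stack: "card (stack l k y xs) = 2 * (k + sum_list (map snd xs))"
proof (induction l k y xs rule: stack.induct)
  case (2 l k y a j xs)
  have "strip l k y \<inter> stack (l - a) j (y + 1) xs = {}"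
    by (auto simp: strip_def dest: stack_above)
  then show ?case
    using 2 by (simp add: card_Un_disjoint finite_stack finite_strip card_strip)
qed (simp add: card_strip)

lemma stack_translate:
  "(\<lambda>(x, y). (x + dx, y + dy)) ` stack l k y xs = stack (l + dx) k (y + dy) xs"
  by (induction l k y xs rule: stack.induct) (simp_all add: image_Un strip_translate algebra_simps)

lemma int_interval_eq:
  assumes "1 \<le> k" "1 \<le> k'" "\<And>x. l \<le> x \<and> x < l + 2 * int k \<longleftrightarrow> l' \<le> x \<and> x < l' + 2 * int k'"
  shows "l = l' \<and> k = k'"
  using assms(1,2) assms(3)[of l] assms(3)[of l'] assms(3)[of "l + 2 * int k - 1"]
    assms(3)[of "l' + 2 * int k' - 1"] by linarith

text \<open>A stack can be read back: its lowest row gives \<open>l\<close> and \<open>k\<close>,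
  and deleting that row leaves the stack of the remaining moves.\<close>

lemma stack_inject:
  assumes "1 \<le> k" "1 \<le> k'" "climbs k xs" "climbs k' xs'" "stack l k y xs = stack l' k' y xs'"
  shows "l = l' \<and> k = k' \<and> xs = xs'"
  using assms
proof (induction xs arbitrary: l k y l' k' xs')
  case (Cons s xs)
  obtain a j where s: "s = (a, j)" by fastforce
  have lk: "l = l' \<and> k = k'"
    using Cons.prems stack_bottom_iff[of _ y l k "s # xs"] stack_bottom_iff[of _ y l' k' xs']
    by (intro int_interval_eq) auto
  have above: "{c \<in> stack l k y (t # ts). y < snd c} = stack (l - fst t) (snd t) (y + 1) ts" for l k y t ts
    by (cases t) (auto simp: strip_def dest: stack_above)
  have bottom: "(l - a, y + 1) \<in> stack l k y (s # xs)"
    using Cons.prems(3) by (simp add: s stack_bottom_iff)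
  obtain a' j' xs'' where xs': "xs' = (a', j') # xs''"
  proof (cases xs')
    case Nil
    then show ?thesis using bottom Cons.prems by (simp add: strip_def)
  qed auto
  have "stack (l - a) j (y + 1) xs = stack (l' - a') j' (y + 1) xs''"
    using Cons.prems(5) above[of l k y s xs] above[of l' k' y "(a', j')" xs''] by (simp add: s xs')
  then have "l - a = l' - a' \<and> j = j' \<and> xs = xs''"
    using Cons.prems by (intro Cons.IH) (auto simp: s xs')
  then show ?case using lk by (auto simp: s xs')
next
  case Nil
  have lk: "l = l' \<and> k = k'"
    using Nil.prems stack_bottom_iff[of _ y l k "[]"] stack_bottom_iff[of _ y l' k' xs']
    by (intro int_interval_eq) auto
  have "xs' = []"
  proof (cases xs')
    case (Cons t ts)
    have "(l' - fst t, y + 1) \<in> stack l' k' y xs'"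
      using Nil.prems Cons by (cases t) (simp add: stack_bottom_iff)
    then have "(l' - fst t, y + 1) \<in> strip l k y" using Nil.prems(5) by simp
    then show ?thesis by (simp add: strip_def)
  qed
  then show ?case using lk by simp
qed

section \<open>Convexity of stacks\<close>

lemma consecutive_atLeastAtMost: "consecutive {l..r}"
  by (auto simp: consecutive_def)

lemma consecutive_empty: "consecutive {}"
  using consecutive_atLeastAtMost[of 1 0] by simp

lemma consecutive_between:
  "consecutive S \<Longrightarrow> u \<in> S \<Longrightarrow> w \<in> S \<Longrightarrow> u \<le> v \<Longrightarrow> v \<le> w \<Longrightarrow> v \<in> S"
  by (auto simp: consecutive_def)

lemma consecutive_stack_row: "consecutive {x. (x, y') \<in> stack l k y xs}"
proof (induction l k y xs rule: stack.induct)
  case (1 l k y)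
  have "{x. (x, y') \<in> strip l k y} = (if y' = y then {l..l + 2 * int k - 1} else {})"
    by (auto simp: strip_def)
  then show ?case by (simp add: consecutive_atLeastAtMost consecutive_empty)
next
  case (2 l k y a j xs)
  show ?case
  proof (cases "y' = y")
    case True
    have "{x. (x, y') \<in> stack l k y ((a, j) # xs)} = {l..l + 2 * int k - 1}"
      unfolding True stack_bottom_iff by auto
    then show ?thesis by (simp only: consecutive_atLeastAtMost)
  next
    case False
    then show ?thesis using 2 by (simp add: strip_def)
  qed
qed

text \<open>
  The flag \<open>p\<close> records that the left border has retreated earlier; then the column just left of the
  current row already has a cell further down, so that the left border cannot advance again.
\<close>

lemma bitonic_if_columns_consecutive:
  assumes "1 \<le> k" "climbs k xs" "\<And>x. consecutive {y'. (x, y') \<in> H \<union> stack l k y xs}"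
    and "\<And>x y'. (x, y') \<in> H \<Longrightarrow> y' < y"
    and "p \<Longrightarrow> \<exists>y'. (l - 1, y') \<in> H" "q \<Longrightarrow> \<exists>y'. (l + 2 * int k, y') \<in> H"
  shows "bitonic p q k xs"
  using assms
proof (induction xs arbitrary: p q k l y H)
  case (Cons s xs)
  obtain a j where s: "s = (a, j)" by fastforce
  let ?P = "H \<union> stack l k y (s # xs)"
  have P: "?P = (H \<union> strip l k y) \<union> stack (l - a) j (y + 1) xs"
    by (auto simp: s)
  have step: "1 \<le> j" "a \<le> 1" "right_growth k a j \<le> 1" "climbs j xs"
    using Cons.prems(2) by (auto simp: s)
  \<comment> \<open>\<open>H\<close> stands for the rows below the current one. A column meeting
    \<open>H\<close> and the next row but not the current row would have a gap at height
    \<open>y\<close>.\<close>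
  have gap: False if "(x, y') \<in> H" "\<not> (l \<le> x \<and> x < l + 2 * int k)"
    "l - a \<le> x \<and> x < l - a + 2 * int j" for x y'
  proof -
    have "(x, y + 1) \<in> ?P" using that(3) unfolding P by (simp add: stack_bottom_iff)
    then have "(x, y) \<in> ?P"
      using consecutive_between[OF Cons.prems(3)[of x], of y' "y + 1" y] that(1) Cons.prems(4)[OF that(1)]
      by auto
    then show False
      using that(2) Cons.prems(4)[of x y] by (auto simp: stack_bottom_iff)
  qed
  have p: "a \<le> 0" if p: p
  proof (rule ccontr)
    assume "\<not> a \<le> 0"
    moreover obtain y' where "(l - 1, y') \<in> H" using Cons.prems(5) p by auto
    ultimately show False using gap[of "l - 1" y'] step by auto
  qed
  have q: "right_growth k a j \<le> 0" if q: q
  proof (rule ccontr)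
    assume "\<not> right_growth k a j \<le> 0"
    moreover obtain y' where "(l + 2 * int k, y') \<in> H" using Cons.prems(6) q by auto
    ultimately show False using gap[of "l + 2 * int k" y'] step by (auto simp: right_growth_def)
  qed
  have "bitonic (p \<or> a < 0) (q \<or> right_growth k a j < 0) j xs"
  proof (rule Cons.IH[where l = "l - a" and y = "y + 1" and H = "H \<union> strip l k y"])
    show "consecutive {y'. (x, y') \<in> (H \<union> strip l k y) \<union> stack (l - a) j (y + 1) xs}" for x
      using Cons.prems(3)[of x] unfolding P .
    show "y' < y + 1" if "(x, y') \<in> H \<union> strip l k y" for x y'
      using that Cons.prems(4)[of x y'] by (auto simp: strip_def)
    show "\<exists>y'. (l - a - 1, y') \<in> H \<union> strip l k y" if "p \<or> a < 0"
    proof (cases "a < 0")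
      case True
      \<comment> \<open>The next row has at least two cells and overhangs on the right by at most
        one, so the cell left of it still lies above the current row.\<close>
      then have "(l - a - 1, y) \<in> strip l k y" using step by (auto simp: strip_def right_growth_def)
      then show ?thesis by blast
    next
      case False
      then have "a = 0" p using that p by auto
      then show ?thesis using Cons.prems(5) by auto
    qed
    show "\<exists>y'. (l - a + 2 * int j, y') \<in> H \<union> strip l k y" if "q \<or> right_growth k a j < 0"
    proof (cases "right_growth k a j < 0")
      case True
      then have "(l - a + 2 * int j, y) \<in> strip l k y" using step by (auto simp: strip_def right_growth_def)
      then show ?thesis by blast
    next
      case False
      then have "right_growth k a j = 0" q using that q by auto
      then have eq: "l - a + 2 * int j = l + 2 * int k" and q by (auto simp: right_growth_def)
      then show ?thesis using Cons.prems(6) unfolding eq by auto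
    qed
  qed (use step in auto)
  then show ?case using p q by (simp add: s)
qed simp

lemma stack_right_of:
  "bitonic True q k xs \<Longrightarrow> (x, y') \<in> stack l k y xs \<Longrightarrow> l \<le> x"
proof (induction l k y xs arbitrary: q rule: stack.induct)
  case (2 l k y a j xs)
  then show ?case by (fastforce simp: strip_def)
qed (auto simp: strip_def)

lemma stack_left_of:
  "bitonic p True k xs \<Longrightarrow> (x, y') \<in> stack l k y xs \<Longrightarrow> x < l + 2 * int k"
proof (induction l k y xs arbitrary: p rule: stack.induct)
  case (2 l k y a j xs)
  then show ?case by (fastforce simp: strip_def right_growth_def)
qed (auto simp: strip_def)

lemma consecutive_stack_column:
  "bitonic p q k xs \<Longrightarrow> consecutive {y'. (x, y') \<in> stack l k y xs}"
proof (induction l k y xs arbitrary: p q rule: stack.induct)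
  case (1 l k y)
  have "{y'. (x, y') \<in> strip l k y} = (if l \<le> x \<and> x < l + 2 * int k then {y..y} else {})"
    by (auto simp: strip_def)
  moreover have "consecutive {y..y}" by (rule consecutive_atLeastAtMost)
  ultimately show ?case by (simp add: consecutive_empty)
next
  case (2 l k y a j xs)
  let ?C = "{y'. (x, y') \<in> stack (l - a) j (y + 1) xs}"
  have C: "consecutive ?C" using 2 by auto
  have bitonic: "bitonic (p \<or> a < 0) (q \<or> right_growth k a j < 0) j xs" using 2 by auto
  have ge: "y + 1 \<le> y'" if "y' \<in> ?C" for y' using that by (auto dest: stack_above)
  show ?case
  proof (cases "l \<le> x \<and> x < l + 2 * int k")
    case False
    then have "{y'. (x, y') \<in> stack l k y ((a, j) # xs)} = ?C" by (auto simp: strip_def)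
    then show ?thesis using C by simp
  next
    case True
    then have eq: "{y'. (x, y') \<in> stack l k y ((a, j) # xs)} = insert y ?C" by (auto simp: strip_def)
    show ?thesis
    proof (cases "y + 1 \<in> ?C")
      case True
      obtain u v where uv: "?C = {u..v}" using C by (auto simp: consecutive_def)
      then have "u \<le> y + 1" "y + 1 \<le> v" using True by auto
      moreover have "y + 1 \<le> u" using ge[of u] uv True by auto
      ultimately have "insert y ?C = {y..v}" unfolding uv by auto
      then show ?thesis unfolding eq by (simp only: consecutive_atLeastAtMost)
    next
      case out: False
      \<comment> \<open>Column \<open>x\<close> leaves the stack across a border that has just
        retreated. That border never advances again, so the column stays empty above.\<close>
      then have "x < l - a \<or> x \<ge> l - a + 2 * int j" by (auto simp: stack_bottom_iff)
      then have "?C = {}"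
      proof
        assume x: "x < l - a"
        then have "bitonic True (q \<or> right_growth k a j < 0) j xs" using True bitonic by simp
        from stack_right_of[OF this] x show ?thesis by fastforce
      next
        assume x: "x \<ge> l - a + 2 * int j"
        then have "right_growth k a j < 0" using True by (auto simp: right_growth_def)
        then have "bitonic (p \<or> a < 0) True j xs" using bitonic by simp
        from stack_left_of[OF this] x show ?thesis by fastforce
      qed
      then have "insert y ?C = {y..y}" by auto
      then show ?thesis unfolding eq by (simp only: consecutive_atLeastAtMost)
    qed
  qed
qed

text \<open>Rows are intervals by construction, so only the columns matter; reading starts with
  nothing below (\<open>H = {}\<close>) and both flags clear.\<close>

lemma convex_stack_iff:
  assumes "1 \<le> k" "climbs k xs"
  shows "convex_polyomino (stack l k y xs) \<longleftrightarrow> bitonic False False k xs"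
proof
  assume "convex_polyomino (stack l k y xs)"
  then show "bitonic False False k xs"
    using assms bitonic_if_columns_consecutive[of k xs "{}" l y False False]
    by (auto simp: convex_polyomino_def)
qed (auto simp: convex_polyomino_def consecutive_stack_row intro: consecutive_stack_column)

lemma stack_row_cards:
  "range (\<lambda>y'. card {x. (x, y') \<in> stack l k y xs}) = insert 0 ((*) 2 ` insert k (snd ` set xs))"
proof (induction l k y xs rule: stack.induct)
  case (1 l k y)
  let ?f = "\<lambda>y'. card {x. (x, y') \<in> strip l k y}"
  have f: "?f y' = (if y' = y then 2 * k else 0)" for y'
  proof -
    have "{x. (x, y') \<in> strip l k y} = (if y' = y then {l..<l + 2 * int k} else {})"
      by (auto simp: strip_def)
    then show ?thesis by (simp add: nat_mult_distrib)
  qed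
  have "2 * k \<in> range ?f" by (rule range_eqI[of _ _ y]) (simp add: f)
  moreover have "0 \<in> range ?f" by (rule range_eqI[of _ _ "y + 1"]) (simp add: f)
  moreover have "range ?f \<subseteq> {0, 2 * k}" by (auto simp: f)
  ultimately have "range ?f = {0, 2 * k}" by blast
  then show ?case by simp
next
  case (2 l k y a j xs)
  let ?f = "\<lambda>y'. card {x. (x, y') \<in> stack l k y ((a, j) # xs)}"
  let ?g = "\<lambda>y'. card {x. (x, y') \<in> stack (l - a) j (y + 1) xs}"
  have "{x. (x, y) \<in> stack l k y ((a, j) # xs)} = {l..<l + 2 * int k}"
    unfolding stack_bottom_iff by auto
  then have y: "?f y = 2 * k" by (simp add: nat_mult_distrib)
  have "{x. (x, y) \<in> stack (l - a) j (y + 1) xs} = {}" by (auto dest: stack_above)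
  then have g: "?g y = 0" by simp
  have other: "?f y' = ?g y'" if "y' \<noteq> y" for y' using that by (simp add: strip_def)
  have "{x. (x, y - 1) \<in> stack (l - a) j (y + 1) xs} = {}" by (auto dest: stack_above)
  then have g': "?g (y - 1) = 0" by simp
  have "range ?f = insert (2 * k) (range ?g)"
  proof (intro equalityI subsetI)
    fix m assume "m \<in> range ?f"
    then obtain y' where "m = ?f y'" by blast
    then show "m \<in> insert (2 * k) (range ?g)" using y other[of y'] by (cases "y' = y") auto
  next
    fix m assume m: "m \<in> insert (2 * k) (range ?g)"
    show "m \<in> range ?f"
    proof (cases "m = 2 * k")
      case True
      then have "m = ?f y" using y by simp
      then show ?thesis by blast
    next
      case False
      then obtain y' where y': "m = ?g y'" using m by blast
      \<comment> \<open>The value \<open>?g y = 0\<close> is lost at \<open>y\<close>, where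
        \<open>?f\<close> sees the bottom row; the empty row \<open>y - 1\<close> supplies
        it.\<close>
      then have "m = ?f (if y' = y then y - 1 else y')"
        using other[of "y - 1"] other[of y'] g g' by auto
      then show ?thesis by blast
    qed
  qed
  then show ?case unfolding 2 by auto
qed

section \<open>Domino towers with consecutive rows\<close>

lemma domino_inject: "domino x y = domino x' y' \<longleftrightarrow> x = x' \<and> y = y'"
proof
  assume eq: "domino x y = domino x' y'"
  have "(x, y) \<in> domino x' y'" "(x + 1, y) \<in> domino x' y'"
    unfolding eq[symmetric] by (auto simp: domino_def)
  then show "x = x' \<and> y = y'" by (auto simp: domino_def)
qed simp

lemma mem_domino_iff: "(u, v) \<in> domino x y \<longleftrightarrow> v = y \<and> (u = x \<or> u = x + 1)"
  by (auto simp: domino_def)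

lemma domino_row_iff: "domino x y \<subseteq> UNIV \<times> {y'} \<longleftrightarrow> y = y'"
  by (auto simp: domino_def)

definition supported :: "cell set set \<Rightarrow> int \<Rightarrow> int \<Rightarrow> bool" where
  "supported D x y \<longleftrightarrow> domino (x - 1) (y - 1) \<in> D \<or> domino x (y - 1) \<in> D \<or> domino (x + 1) (y - 1) \<in> D"

text \<open>Forgets the order of placing. What is kept survives further placing, because support in
  \<open>D\<close> remains support in a larger set; \<open>y0\<close> is the height of the
  base.\<close>

lemma domino_tower_props:
  assumes "domino_tower n b' D"
  shows "finite D \<and> card D = n \<and> D \<noteq> {} \<and> (\<forall>d\<in>D. \<exists>x y. d = domino x y) \<and> disjoint D \<and>
    (\<exists>y0. \<forall>x y. domino x y \<in> D \<longrightarrow> y = y0 \<or> y0 < y \<and> supported D x y)"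
  using assms
proof (induction rule: domino_tower.induct)
  case (base b' x y)
  let ?d = "\<lambda>j. domino (x + 2 * int j) y"
  have "inj_on ?d {0..<b'}" by (auto simp: inj_on_def domino_inject)
  moreover have "disjoint (?d ` {0..<b'})"
  proof (rule disjointI)
    fix d d' assume "d \<in> ?d ` {0..<b'}" "d' \<in> ?d ` {0..<b'}" "d \<noteq> d'"
    then obtain i j where "d = ?d i" "d' = ?d j" "i \<noteq> j" by auto
    then show "d \<inter> d' = {}" by (auto simp: domino_def)
  qed
  moreover have "\<exists>y0. \<forall>x' y'. domino x' y' \<in> ?d ` {0..<b'} \<longrightarrow>
      y' = y0 \<or> y0 < y' \<and> supported (?d ` {0..<b'}) x' y'"
    by (intro exI[of _ y]) (auto simp: domino_inject)
  ultimately show ?case using base by (auto simp: card_image)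
next
  case (place n b' D x y)
  let ?D = "insert (domino x y) D"
  have new: "domino x y \<notin> D"
  proof
    assume "domino x y \<in> D"
    then have "domino x y \<subseteq> \<Union>D" by blast
    then show False using place.hyps(2) by (auto simp: domino_def)
  qed
  have IH: "finite D" "card D = n" "\<forall>d\<in>D. \<exists>x y. d = domino x y" "disjoint D"
    using place.IH by simp_all
  obtain y0 where y0: "\<And>x y. domino x y \<in> D \<Longrightarrow> y = y0 \<or> y0 < y \<and> supported D x y"
    using place.IH by blast
  have sup: "supported D x y" using place.hyps(3) by (simp add: supported_def)
  obtain u where "domino u (y - 1) \<in> D" using place.hyps(3) by blast
  from y0[OF this] have "y0 < y" by auto
  have mono: "supported ?D x' y'" if "supported D x' y'" for x' y'
    using that by (auto simp: supported_def)
  have "y' = y0 \<or> y0 < y' \<and> supported ?D x' y'" if "domino x' y' \<in> ?D" for x' y'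
  proof (cases "domino x' y' \<in> D")
    case True
    then show ?thesis using y0 mono by blast
  next
    case False
    then have "x' = x" "y' = y" using that by (auto simp: domino_inject)
    then show ?thesis using sup mono \<open>y0 < y\<close> by blast
  qed
  moreover have "disjoint ?D"
    using IH(4) place.hyps(2) by (auto simp: pairwise_insert disjnt_def)
  moreover have "finite ?D" "card ?D = Suc n" "\<forall>d\<in>?D. \<exists>x y. d = domino x y"
    using IH new by auto
  ultimately show ?case by blast
qed

text \<open>A row consists of the left ends of its dominoes and of these moved by one. A common
  element of the two sets would be a cell of two dominoes.\<close>

lemma domino_row_card:
  assumes D: "finite D" "\<forall>d\<in>D. \<exists>x y. d = domino x y" "disjoint D"
  shows "card {x. (x, y) \<in> \<Union>D} = 2 * row_length D y"
proof -
  let ?X = "{x. domino x y \<in> D}"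
  have img: "{d \<in> D. d \<subseteq> UNIV \<times> {y}} = (\<lambda>x. domino x y) ` ?X"
  proof (intro equalityI subsetI)
    fix d assume d: "d \<in> {d \<in> D. d \<subseteq> UNIV \<times> {y}}"
    then obtain x y' where "d = domino x y'" using bspec[OF D(2), of d] by blast
    then show "d \<in> (\<lambda>x. domino x y) ` ?X" using d by (auto simp: domino_row_iff)
  qed (auto simp: mem_domino_iff)
  have inj: "inj_on (\<lambda>x. domino x y) ?X" by (auto simp: inj_on_def domino_inject)
  have "finite ((\<lambda>x. domino x y) ` ?X)" unfolding img[symmetric] using D(1) by simp
  then have fin: "finite ?X" using inj by (rule finite_imageD)
  have cells: "{x. (x, y) \<in> \<Union>D} = ?X \<union> (\<lambda>x. x + 1) ` ?X"
  proof (intro equalityI subsetI)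
    fix x assume "x \<in> {x. (x, y) \<in> \<Union>D}"
    then obtain d where d: "d \<in> D" "(x, y) \<in> d" by blast
    moreover obtain x' y' where "d = domino x' y'" using bspec[OF D(2) d(1)] by blast
    ultimately have "domino x' y' \<in> D" "(x, y) \<in> domino x' y'" by simp_all
    then show "x \<in> ?X \<union> (\<lambda>x. x + 1) ` ?X" by (auto simp: mem_domino_iff)
  next
    fix x assume "x \<in> ?X \<union> (\<lambda>x. x + 1) ` ?X"
    then have "domino x y \<in> D \<or> domino (x - 1) y \<in> D" by auto
    moreover have "(x, y) \<in> domino x y" "(x, y) \<in> domino (x - 1) y" by (simp_all add: mem_domino_iff)
    ultimately show "x \<in> {x. (x, y) \<in> \<Union>D}" by blast
  qed
  have "?X \<inter> (\<lambda>x. x + 1) ` ?X = {}"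
  proof (rule ccontr)
    assume "?X \<inter> (\<lambda>x. x + 1) ` ?X \<noteq> {}"
    then obtain u where "u \<in> ?X" "u \<in> (\<lambda>x. x + 1) ` ?X" by blast
    then obtain x where "domino (x + 1) y \<in> D" "domino x y \<in> D" by (elim imageE) simp
    moreover have "domino (x + 1) y \<noteq> domino x y" by (simp add: domino_inject)
    ultimately have "domino (x + 1) y \<inter> domino x y = {}"
      by (rule disjointD[OF D(3)])
    then show False by (auto simp: domino_def)
  qed
  then have "card (?X \<union> (\<lambda>x. x + 1) ` ?X) = card ?X + card ((\<lambda>x. x + 1) ` ?X)"
    using fin by (intro card_Un_disjoint) auto
  moreover have "card ((\<lambda>x. x + 1) ` ?X) = card ?X"
    by (rule card_image) simp
  ultimately show ?thesis
    unfolding cells row_length_def img card_image[OF inj] by simp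
qed

lemma card_domino_union:
  assumes D: "finite D" "\<forall>d\<in>D. \<exists>x y. d = domino x y" "disjoint D"
  shows "card (\<Union>D) = 2 * card D"
proof -
  have c: "card d = 2" "finite d" if d: "d \<in> D" for d
  proof -
    obtain x y where "d = domino x y" using bspec[OF D(2) d] by blast
    then show "card d = 2" "finite d" by (simp_all add: domino_def)
  qed
  have "card (\<Union>D) = (\<Sum>d\<in>D. card d)"
    by (rule card_Union_disjoint[OF D(3) c(2)])
  also have "\<dots> = (\<Sum>d\<in>D. 2)"
    by (rule sum.cong[OF refl c(1)])
  finally show ?thesis by simp
qed

text \<open>Rows are read off from the bottom upwards. Each is an interval of even length, none is
  skipped because support leads downwards, and the support of the outermost dominoes limits the
  overhang to one cell.\<close>

lemma stack_of_domino_rows: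
  assumes D: "finite D" "\<forall>d\<in>D. \<exists>x y. d = domino x y" "disjoint D"
    and sup: "\<And>x y. domino x y \<in> D \<Longrightarrow> y = y0 \<or> y0 < y \<and> supported D x y"
    and rows: "\<And>y. consecutive {x. (x, y) \<in> \<Union>D}" and "D \<noteq> {}"
  shows "\<exists>l k xs. 1 \<le> k \<and> climbs k xs \<and> \<Union>D = stack l k y0 xs"
proof -
  define P where "P = \<Union>D"
  have cell: "\<exists>x'. domino x' y \<in> D \<and> (x' = x \<or> x' = x - 1)" if c: "(x, y) \<in> P" for x y
  proof -
    obtain d where d: "d \<in> D" "(x, y) \<in> d" using c unfolding P_def by blast
    then obtain x' y' where "d = domino x' y'" using bspec[OF D(2) d(1)] by blast
    then have "domino x' y \<in> D \<and> (x' = x \<or> x' = x - 1)"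
      using d by (auto simp: mem_domino_iff)
    then show ?thesis by blast
  qed
  have dom: "(x, y) \<in> P" "(x + 1, y) \<in> P" if "domino x y \<in> D" for x y
  proof -
    have "(x, y) \<in> domino x y" "(x + 1, y) \<in> domino x y" by (simp_all add: mem_domino_iff)
    then show "(x, y) \<in> P" "(x + 1, y) \<in> P" using that unfolding P_def by blast+
  qed
  have "finite d" if d: "d \<in> D" for d
  proof -
    obtain x y where "d = domino x y" using bspec[OF D(2) d] by blast
    then show ?thesis by (simp add: domino_def)
  qed
  then have fin: "finite P" using D(1) unfolding P_def by blast
  have row: "\<exists>l k. 1 \<le> k \<and> (\<forall>x. (x, y) \<in> P \<longleftrightarrow> l \<le> x \<and> x < l + 2 * int k)"
    if ne: "(x, y) \<in> P" for x y
  proof -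
    obtain l r where lr: "{x. (x, y) \<in> P} = {l..r}" using rows[of y] unfolding P_def by (auto simp: consecutive_def)
    then have "l \<le> x" "x \<le> r" using ne by auto
    then have "int (card {x. (x, y) \<in> P}) = r - l + 1" unfolding lr by simp
    then have "r = l + 2 * int (row_length D y) - 1"
      unfolding P_def domino_row_card[OF D] by simp
    then show ?thesis
      using lr \<open>l \<le> x\<close> \<open>x \<le> r\<close> by (intro exI[of _ l] exI[of _ "row_length D y"]) auto
  qed
  have descend: "\<exists>x. (x, y) \<in> P" if "(x', y + int m) \<in> P" "y0 \<le> y" for x' y m
    using that
  proof (induction m arbitrary: x')
    case (Suc m)
    obtain u where "domino u (y + int (Suc m)) \<in> D" using cell Suc.prems(1) by blast
    with sup[OF this] Suc.prems(2) have "supported D u (y + int (Suc m))" by auto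
    then obtain v where "domino v (y + int m) \<in> D" unfolding supported_def by (auto simp: algebra_simps)
    then show ?case using Suc.IH Suc.prems dom by blast
  qed auto
  have build: "\<exists>xs. climbs k xs \<and> {c \<in> P. y \<le> snd c} = stack l k y xs"
    if "1 \<le> k" "y0 \<le> y" "\<And>x. (x, y) \<in> P \<longleftrightarrow> l \<le> x \<and> x < l + 2 * int k"
      "\<And>x y'. (x, y') \<in> P \<Longrightarrow> y' \<le> y + int m" for l k y m
    using that
  proof (induction m arbitrary: l k y)
    case 0
    have "{c \<in> P. y \<le> snd c} = strip l k y"
    proof (rule set_eqI)
      fix c :: cell
      obtain x y' where c: "c = (x, y')" by fastforce
      have top: "y' \<le> y" if "(x, y') \<in> P" using 0(4)[OF that] by simp
      show "c \<in> {c \<in> P. y \<le> snd c} \<longleftrightarrow> c \<in> strip l k y"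
        using 0(3)[of x] top unfolding c strip_def by (cases "y' = y") auto
    qed
    then show ?case by (intro exI[of _ "[]"]) simp
  next
    case (Suc m)
    have split: "{c \<in> P. y \<le> snd c} = strip l k y \<union> {c \<in> P. y + 1 \<le> snd c}"
    proof (rule set_eqI)
      fix c :: cell
      obtain x y' where c: "c = (x, y')" by fastforce
      show "c \<in> {c \<in> P. y \<le> snd c} \<longleftrightarrow> c \<in> strip l k y \<union> {c \<in> P. y + 1 \<le> snd c}"
        using Suc.prems(3)[of x] unfolding c strip_def by (cases "y' = y") auto
    qed
    show ?case
    proof (cases "{c \<in> P. y + 1 \<le> snd c} = {}")
      case True
      then show ?thesis using split unfolding True by (intro exI[of _ "[]"]) simp
    next
      case False
      then obtain x y' where "(x, y') \<in> P" "y + 1 \<le> y'" by auto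
      then have "(x, (y + 1) + int (nat (y' - (y + 1)))) \<in> P" by simp
      then have "\<exists>x. (x, y + 1) \<in> P" using Suc.prems(2) by (elim descend) simp
      then obtain x where "(x, y + 1) \<in> P" by blast
      then obtain l' k' where row': "1 \<le> k'"
        "\<And>x. (x, y + 1) \<in> P \<longleftrightarrow> l' \<le> x \<and> x < l' + 2 * int k'"
        using row by blast
      obtain xs where xs: "climbs k' xs" "{c \<in> P. y + 1 \<le> snd c} = stack l' k' (y + 1) xs"
        using Suc.IH[of k' "y + 1" l'] row' Suc.prems by (auto simp: algebra_simps)
      have reach: "\<exists>v\<in>{u - 1..u + 1}. l \<le> v \<and> v + 1 < l + 2 * int k" if u: "domino u (y + 1) \<in> D" for u
      proof -
        have "supported D u (y + 1)" using sup[OF u] Suc.prems(2) by auto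
        then obtain v where v: "domino v y \<in> D" "v \<in> {u - 1..u + 1}" by (auto simp: supported_def)
        have "l \<le> v" "v + 1 < l + 2 * int k"
          using dom[OF v(1)] unfolding Suc.prems(3) by simp_all
        then show ?thesis using v(2) by blast
      qed
      \<comment> \<open>Cell \<open>l'\<close> is the leftmost of its row, so the domino covering it
        starts there; likewise the last domino ends at the right border.\<close>
      have "domino l' (y + 1) \<in> D"
      proof -
        have "(l', y + 1) \<in> P" "(l' - 1, y + 1) \<notin> P" unfolding row'(2) using row'(1) by simp_all
        then show ?thesis using cell[of l' "y + 1"] dom(1)[of "l' - 1" "y + 1"] by blast
      qed
      from reach[OF this] have left: "l - l' \<le> 1" by auto
      have "domino (l' + 2 * int k' - 2) (y + 1) \<in> D"
      proof -
        let ?x = "l' + 2 * int k' - 1"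
        have "(?x, y + 1) \<in> P" "(?x + 1, y + 1) \<notin> P" unfolding row'(2) using row'(1) by simp_all
        then have "domino (?x - 1) (y + 1) \<in> D"
          using cell[of ?x "y + 1"] dom(2)[of ?x "y + 1"] by blast
        then show ?thesis by simp
      qed
      from reach[OF this] have "right_growth k (l - l') k' \<le> 1" by (auto simp: right_growth_def)
      then show ?thesis
        using left xs row'(1) split by (intro exI[of _ "(l - l', k') # xs"]) simp
    qed
  qed
  have low: "y0 \<le> y" if c: "(x, y) \<in> P" for x y
  proof -
    obtain u where "domino u y \<in> D" using cell[OF c] by blast
    from sup[OF this] show ?thesis by auto
  qed
  obtain d where "d \<in> D" using \<open>D \<noteq> {}\<close> by blast
  then obtain u v where "domino u v \<in> D" using bspec[OF D(2)] by metis
  then obtain x y where xy: "(x, y) \<in> P" using dom(1) by blast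
  then have "(x, y0 + int (nat (y - y0))) \<in> P" using low by simp
  then obtain x0 where "(x0, y0) \<in> P" using descend by blast
  then obtain l k where lk: "1 \<le> k" "\<And>x. (x, y0) \<in> P \<longleftrightarrow> l \<le> x \<and> x < l + 2 * int k"
    using row by blast
  obtain M where M: "\<And>c. c \<in> P \<Longrightarrow> snd c \<le> M"
    using fin bdd_above_finite[of "snd ` P"] by (auto simp: bdd_above_def)
  have "y' \<le> y0 + int (nat (M - y0))" if "(x, y') \<in> P" for x y'
    using M[OF that] by simp
  then obtain xs where xs: "climbs k xs" "{c \<in> P. y0 \<le> snd c} = stack l k y0 xs"
    using build[of k y0 l "nat (M - y0)"] lk by auto
  moreover have "{c \<in> P. y0 \<le> snd c} = P" using low by auto
  ultimately have "P = stack l k y0 xs" by simp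
  then show ?thesis using lk(1) xs(1) unfolding P_def by blast
qed

section \<open>Building a tower for a given stack\<close>

definition domino_row :: "int \<Rightarrow> nat \<Rightarrow> int \<Rightarrow> cell set set" where
  "domino_row l k y = (\<lambda>j. domino (l + 2 * int j) y) ` {0..<k}"

lemma Union_domino_row: "\<Union>(domino_row l k y) = strip l k y"
proof (induction k)
  case (Suc k)
  have "domino_row l (Suc k) y = insert (domino (l + 2 * int k) y) (domino_row l k y)"
    by (simp add: domino_row_def atLeast0_lessThan_Suc)
  moreover have "strip l (Suc k) y = domino (l + 2 * int k) y \<union> strip l k y"
    by (auto simp: strip_def domino_def)
  ultimately show ?case using Suc by simp
qed (simp add: domino_row_def strip_def)

text \<open>Every domino of the new row rests on the row below, so the row can be filled from left
  to right; \<open>m\<close> is the number placed so far.\<close>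

lemma domino_tower_add_row:
  assumes tower: "domino_tower n b' D" and row: "domino_row l k y \<subseteq> D" and k: "1 \<le> k"
    and below: "\<And>x y'. (x, y') \<in> \<Union>D \<Longrightarrow> y' \<le> y" and step: "a \<le> 1" "right_growth k a j \<le> 1"
  shows "m \<le> j \<Longrightarrow> domino_tower (n + m) b' (D \<union> domino_row (l - a) m (y + 1))"
proof (induction m)
  case (Suc m)
  let ?x = "l - a + 2 * int m"
  let ?D = "D \<union> domino_row (l - a) m (y + 1)"
  have range: "l - 1 \<le> ?x" "?x \<le> l + 2 * int k - 1"
    using step Suc.prems by (auto simp: right_growth_def)
  \<comment> \<open>The support has index \<open>(?x - l) div 2\<close> and starts at
    \<open>?x\<close> or \<open>?x - 1\<close>; only for \<open>?x = l - 1\<close> does the first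
    domino of the row below, starting at \<open>?x + 1\<close>, serve instead.\<close>
  have "\<exists>i<k. ?x - 1 = l + 2 * int i \<or> ?x = l + 2 * int i \<or> ?x + 1 = l + 2 * int i"
  proof (cases "?x = l - 1")
    case True
    then show ?thesis using k by (intro exI[of _ 0]) auto
  next
    case False
    then have "int (nat ((?x - l) div 2)) = (?x - l) div 2" using range by simp
    then obtain i where "int i = (?x - l) div 2" by blast
    then have "i < k" "?x - 1 = l + 2 * int i \<or> ?x = l + 2 * int i"
      using range by presburger+
    then show ?thesis by blast
  qed
  then obtain i where i: "i < k" "?x - 1 = l + 2 * int i \<or> ?x = l + 2 * int i \<or> ?x + 1 = l + 2 * int i"
    by blast
  have "domino (l + 2 * int i) y \<in> ?D"
    using row i(1) by (auto simp: domino_row_def)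
  then have "domino (?x - 1) y \<in> ?D \<or> domino ?x y \<in> ?D \<or> domino (?x + 1) y \<in> ?D"
    using i(2) by metis
  moreover have "domino ?x (y + 1) \<inter> \<Union>D = {}"
    using below[of ?x "y + 1"] below[of "?x + 1" "y + 1"] unfolding domino_def by fastforce
  then have "domino ?x (y + 1) \<inter> \<Union>?D = {}"
    unfolding Union_Un_distrib Union_domino_row Int_Un_distrib by (auto simp: domino_def strip_def)
  ultimately have "domino_tower (Suc (n + m)) b' (insert (domino ?x (y + 1)) ?D)"
    using Suc by (intro domino_tower.place) simp_all
  then show ?case by (simp add: domino_row_def atLeast0_lessThan_Suc)
qed (use tower in \<open>simp add: domino_row_def\<close>)

text \<open>The invariant carries the tiling \<open>domino_row l k y\<close> of the top row, since
  this is where the next row finds its support.\<close>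

lemma domino_tower_extend:
  assumes "domino_tower n b' D" "domino_row l k y \<subseteq> D" "1 \<le> k"
    and "\<And>x y'. (x, y') \<in> \<Union>D \<Longrightarrow> y' \<le> y" "climbs k xs"
  shows "\<exists>D'. domino_tower (n + sum_list (map snd xs)) b' D' \<and> \<Union>D' = \<Union>D \<union> stack l k y xs"
  using assms
proof (induction xs arbitrary: n D l k y)
  case Nil
  have "stack l k y [] \<subseteq> \<Union>D"
    using Nil.prems(2) unfolding stack.simps Union_domino_row[symmetric] by blast
  then show ?case using Nil.prems by (intro exI[of _ D]) auto
next
  case (Cons s xs)
  obtain a j where s: "s = (a, j)" by fastforce
  have step: "1 \<le> j" "a \<le> 1" "right_growth k a j \<le> 1" "climbs j xs"
    using Cons.prems(5) by (auto simp: s)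
  let ?D = "D \<union> domino_row (l - a) j (y + 1)"
  have U: "\<Union>?D = \<Union>D \<union> strip (l - a) j (y + 1)" by (simp add: Union_domino_row)
  have "domino_tower (n + j) b' ?D"
    using step by (intro domino_tower_add_row[OF Cons.prems(1-3)]) (use Cons.prems(4) in blast, auto)
  moreover have "y' \<le> y + 1" if "(x, y') \<in> \<Union>?D" for x y'
    using that Cons.prems(4)[of x y'] unfolding U Un_iff strip_def by fastforce
  ultimately obtain D' where D': "domino_tower (n + j + sum_list (map snd xs)) b' D'"
    "\<Union>D' = \<Union>?D \<union> stack (l - a) j (y + 1) xs"
    using Cons.IH[of "n + j" ?D "l - a" j "y + 1"] step by auto
  have "strip l k y \<subseteq> \<Union>D"
    using Cons.prems(2) unfolding Union_domino_row[symmetric] by blast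
  then have "\<Union>D' = \<Union>D \<union> stack l k y (s # xs)"
    unfolding D'(2) U s stack.simps using strip_subset_stack by blast
  then show ?case using D'(1) by (intro exI[of _ D']) (simp add: s add.assoc)
qed

lemma domino_tower_stack:
  assumes "1 \<le> k" "climbs k xs"
  shows "\<exists>D. domino_tower (k + sum_list (map snd xs)) k D \<and> \<Union>D = stack l k y xs"
proof -
  have "domino_tower k k (domino_row l k y)"
    unfolding domino_row_def by (rule domino_tower.base[OF assms(1)])
  from domino_tower_extend[OF this order_refl assms(1) _ assms(2)]
  obtain D where "domino_tower (k + sum_list (map snd xs)) k D" "\<Union>D = strip l k y \<union> stack l k y xs"
    unfolding Union_domino_row by (auto simp: strip_def)
  then show ?thesis using strip_subset_stack[of l k y xs] by auto
qed

lemma Max_row_length: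
  assumes D: "finite D" "\<forall>d\<in>D. \<exists>x y. d = domino x y" "disjoint D"
    and stack: "\<Union>D = stack l k y xs" and b: "1 \<le> b"
  shows "Max (range (row_length D)) = b \<longleftrightarrow>
    k \<le> b \<and> (\<forall>s\<in>set xs. snd s \<le> b) \<and> (k = b \<or> b \<in> snd ` set xs)"
proof -
  have "(*) 2 ` range (row_length D) = range (\<lambda>y'. card {x. (x, y') \<in> stack l k y xs})"
    unfolding stack[symmetric] domino_row_card[OF D] by auto
  also have "\<dots> = (*) 2 ` insert 0 (insert k (snd ` set xs))"
    unfolding stack_row_cards by simp
  finally have "range (row_length D) = insert 0 (insert k (snd ` set xs))"
    by (subst (asm) inj_image_eq_iff) (auto simp: inj_def)
  \<comment> \<open>The value 0 comes from rows missing the tower; as \<open>b \<ge> 1\<close>, it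
    is never the maximum sought.\<close>
  moreover have "Max (insert 0 (insert k (snd ` set xs))) = b \<longleftrightarrow>
      b \<in> insert 0 (insert k (snd ` set xs)) \<and> (\<forall>m\<in>insert 0 (insert k (snd ` set xs)). m \<le> b)"
    by (rule Max_eq_iff) auto
  ultimately show ?thesis using b by auto
qed

section \<open>Counting convex towers\<close>

definition codes :: "nat \<Rightarrow> nat \<Rightarrow> (nat \<times> (int \<times> nat) list) set" where
  "codes b n = {(k, xs). 1 \<le> k \<and> k \<le> b \<and> k + sum_list (map snd xs) = n \<and>
    run b (\<lambda>p q h. h) False False (k = b) k xs}"

lemma convex_towers_eq:
  assumes b: "1 \<le> b"
  shows "convex_towers b n = {stack l k y xs | l k y xs. (k, xs) \<in> codes b n}"
proof (intro equalityI subsetI)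
  fix P assume "P \<in> convex_towers b n"
  then obtain D b' where P: "P = \<Union>D" "domino_tower n b' D" "convex_polyomino (\<Union>D)"
    "Max (range (row_length D)) = b"
    by (auto simp: convex_towers_def)
  obtain y0 where D: "finite D" "\<forall>d\<in>D. \<exists>x y. d = domino x y" "disjoint D" "card D = n" "D \<noteq> {}"
    and y0: "\<And>x y. domino x y \<in> D \<Longrightarrow> y = y0 \<or> y0 < y \<and> supported D x y"
    using domino_tower_props[OF P(2)] by blast
  have "consecutive {x. (x, y) \<in> \<Union>D}" for y using P(3) by (simp add: convex_polyomino_def)
  from stack_of_domino_rows[OF D(1-3) y0 this D(5)]
  obtain l k xs where st: "1 \<le> k" "climbs k xs" "\<Union>D = stack l k y0 xs" by auto
  have "bitonic False False k xs" using P(3) convex_stack_iff[OF st(1,2)] st(3) by simp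
  moreover have "k + sum_list (map snd xs) = n"
    using card_domino_union[OF D(1-3)] D(4) card_stack[of l k y0 xs] st(3) by simp
  ultimately have "(k, xs) \<in> codes b n"
    using Max_row_length[OF D(1-3) st(3) b] P(4) st
    by (simp add: codes_def run_iff_climbs_bitonic)
  then show "P \<in> {stack l k y xs | l k y xs. (k, xs) \<in> codes b n}" using P(1) st(3) by blast
next
  fix P assume "P \<in> {stack l k y xs | l k y xs. (k, xs) \<in> codes b n}"
  then obtain l k y xs where P: "P = stack l k y xs" and code: "1 \<le> k" "k \<le> b"
    "k + sum_list (map snd xs) = n" "run b (\<lambda>p q h. h) False False (k = b) k xs"
    by (auto simp: codes_def)
  note run = code(4)[unfolded run_iff_climbs_bitonic]
  obtain D where D: "domino_tower n k D" "\<Union>D = P"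
    using domino_tower_stack[of k xs l y] code run P by auto
  note props = domino_tower_props[OF D(1)]
  have "Max (range (row_length D)) = b"
    using Max_row_length[of D l k y xs b] props D(2) P b code run by auto
  moreover have "convex_polyomino (\<Union>D)"
    using convex_stack_iff[of k xs] code run by (simp add: D(2) P)
  ultimately show "P \<in> convex_towers b n"
    using D unfolding convex_towers_def by blast
qed

text \<open>Each translation class is represented by a stack whose bottom row starts at the origin,
  and its code can be read back.\<close>

lemma num_convex_towers_eq_card_codes:
  assumes "1 \<le> b"
  shows "num_convex_towers b n = card (codes b n)"
proof -
  let ?f = "\<lambda>(k, xs). translation_rel `` {stack 0 k 0 xs}"
  have rel: "(stack l k y xs, stack l' k y' xs) \<in> translation_rel" for l k y xs l' y'
    using stack_translate[of "l' - l" "y' - y" l k y xs] unfolding translation_rel_def by auto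
  have "convex_towers b n // translation_rel = ?f ` codes b n"
  proof (intro equalityI subsetI)
    fix X assume "X \<in> convex_towers b n // translation_rel"
    then obtain l k y xs where X: "X = translation_rel `` {stack l k y xs}" "(k, xs) \<in> codes b n"
      unfolding convex_towers_eq[OF assms] by (auto elim!: quotientE)
    then have "X = translation_rel `` {stack 0 k 0 xs}"
      using equiv_class_eq[OF equiv_translation_rel rel[of l k y xs 0 0]] by simp
    then show "X \<in> ?f ` codes b n" using X(2) by (auto intro: rev_image_eqI)
  next
    fix X assume "X \<in> ?f ` codes b n"
    then obtain k xs where "X = translation_rel `` {stack 0 k 0 xs}" "(k, xs) \<in> codes b n" by auto
    then show "X \<in> convex_towers b n // translation_rel"
      unfolding convex_towers_eq[OF assms] by (auto intro!: quotientI)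
  qed
  moreover have "inj_on ?f (codes b n)"
  proof (rule inj_onI, clarify)
    fix k xs k' xs'
    assume c: "(k, xs) \<in> codes b n" "(k', xs') \<in> codes b n"
      and eq: "translation_rel `` {stack 0 k 0 xs} = translation_rel `` {stack 0 k' 0 xs'}"
    have *: "1 \<le> k" "1 \<le> k'" "climbs k xs" "climbs k' xs'"
      using c by (auto simp: codes_def run_iff_climbs_bitonic)
    have "(stack 0 k 0 xs, stack 0 k' 0 xs') \<in> translation_rel"
      using eq_equiv_class[OF eq equiv_translation_rel] by simp
    then obtain dx dy where st: "stack 0 k' 0 xs' = stack dx k dy xs"
      using stack_translate[of _ _ 0 k 0 xs] by (auto simp: translation_rel_def)
    \<comment> \<open>Each stack contains the lower left cell of the other, so the bottom rows have
      the same height.\<close>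
    have "(0, 0) \<in> stack dx k dy xs" "(dx, dy) \<in> stack 0 k' 0 xs'"
      using stack_bottom_iff[of 0 0 0 k' xs'] stack_bottom_iff[of dx dy dx k xs] * st by auto
    then have "dy = 0" using stack_above[of 0 0 dx k dy xs] stack_above[of dx dy 0 k' 0 xs'] by simp
    then show "k = k' \<and> xs = xs'"
      using stack_inject[OF *(1,2,3,4), of dx 0 0] st by auto
  qed
  ultimately show ?thesis
    by (simp add: num_convex_towers_def card_image)
qed

text \<open>The bottom row uses up \<open>k\<close> dominoes, leaving \<open>n - k\<close> for the
  moves; \<open>k \<le> n\<close> guards the truncated subtraction.\<close>

lemma card_codes:
  "card (codes b n) = (\<Sum>k=1..b. if k \<le> n then
    card (runs b (\<lambda>p q h. h) False False (k = b) k (n - k)) else 0)"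
proof -
  let ?R = "\<lambda>k. runs b (\<lambda>p q h. h) False False (k = b) k (n - k)"
  have "codes b n = (SIGMA k:{k \<in> {1..b}. k \<le> n}. ?R k)"
    by (auto simp: codes_def runs_def)
  then have "card (codes b n) = (\<Sum>k\<in>{k \<in> {1..b}. k \<le> n}. card (?R k))"
    by (simp add: finite_runs)
  also have "\<dots> = (\<Sum>k=1..b. if k \<le> n then card (?R k) else 0)"
    by (rule sum.inter_filter) simp
  finally show ?thesis .
qed

theorem theorem3p5:
  fixes b :: nat
  assumes "b \<ge> 1"
  shows "(\<lambda>n. real (num_convex_towers b n)) \<sim>[sequentially]
    (\<lambda>n. 2 powi (int n - int b + 1) * (\<Prod>k=1..b-1. 2 ^ k / (2 ^ k - 1)) *
      (1 + (\<Sum>i\<in>{0..<b-1}. 1 / (\<Prod>k=i+1..b-1. (2 ^ k - 1)))))"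
  using assms num_convex_towers_eq_card_codes[OF assms] card_codes
  by (intro runs_total_asymptotics) simp_all

end
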